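(* Let $\{\boldsymbol{Y}_k : k = 0,1,2,\dots\}$ be a matrix martingale whose values are matrices of dimension $d_1\times d_2$, with $\boldsymbol{Y}_0=\boldsymbol{0}$, and let $\boldsymbol{X}_k = \boldsymbol{Y}_k - \boldsymbol{Y}_{k-1}$, $k=1,2,3,\dots$, be its difference sequence. Assume that for a real constant $R$, $$\|\boldsymbol{X}_k\| \leq R \quad\text{almost surely, for } k=1,2,3,\dots.$$ Define two predictable quadratic variation processes for this martingale by $$\boldsymbol{W}_{\mathrm{col},k} := \sum_{j=1}^k \mathbb{E}_{j-1}\big(\boldsymbol{X}_j\boldsymbol{X}_j^{*}\big)\quad\text{and}\quad \boldsymbol{W}_{\mathrm{row},k} := \sum_{j=1}^k \mathbb{E}_{j-1}\big(\boldsymbol{X}_j^{*}\boldsymbol{X}_j\big)\quad\text{for } k=1,2,3,\dots,$$ with $\boldsymbol{W}_{\mathrm{col},0}:=\boldsymbol{0}$ and $\boldsymbol{W}_{\mathrm{row},0}:=\boldsymbol{0}$. Then, for all $t\geq 0$ and $\sigma^2>0$, $$\mathbb{P}\left\{ \exists\, k\geq 0 : \|\boldsymbol{Y}_k\|\geq t \ \text{ and }\ \max\{\|\boldsymbol{W}_{\mathrm{col},k}\|,\ \|\boldsymbol{W}_{\mathrm{row},k}\|\}\leq \sigma^2 \right\} \leq (d_1+d_2)\cdot \exp\left\{ \frac{-t^2/2}{\sigma^2 + Rt/3}\right\}.$$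
   Context: Let $(\Omega,\mathscr{F},\mathbb{P})$ be a probability space with a filtration $\mathscr{F}_0\subset\mathscr{F}_1\subset\mathscr{F}_2\subset\dots\subset\mathscr{F}$; $\mathbb{E}_k$ denotes expectation conditioned on $\mathscr{F}_k$. $\|\cdot\|$ denotes the spectral norm (largest singular value) and ${}^*$ the conjugate transpose. A random process $\{\boldsymbol{Y}_k : k=0,1,2,\dots\}$ with values in matrices of a fixed finite dimension is a matrix martingale when it is adapted to the filtration, $\mathbb{E}_{k-1}\boldsymbol{Y}_k=\boldsymbol{Y}_{k-1}$ and $\mathbb{E}\|\boldsymbol{Y}_k\|<+\infty$ for $k=1,2,3,\dots$; throughout it is assumed that $\boldsymbol{Y}_0=\boldsymbol{0}$. *)

theory Defs
  imports "HOL-Probability.Probability"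
begin

text \<open>
  A complex matrix with rows indexed by \<open>'r\<close> and columns indexed by \<open>'c\<close>
  has type \<open>complex ^ 'c ^ 'r\<close>.
\<close>

definition cadjoint :: "complex ^ 'c ^ 'r \<Rightarrow> complex ^ 'r ^ 'c"
  where "cadjoint A = (\<chi> i j. cnj (A $ j $ i))"

definition singular_value :: "complex ^ 'c ^ 'r \<Rightarrow> real \<Rightarrow> bool"
  where "singular_value A s \<longleftrightarrow>
    0 \<le> s \<and> (\<exists>v. v \<noteq> 0 \<and> (cadjoint A ** A) *v v = complex_of_real (s\<^sup>2) *s v)"

text \<open>
  The greatest element exists by \<open>singular_value_onorm\<close> and
  \<open>singular_value_le_onorm\<close> below. Square roots of eigenvalues of \<open>A\<^sup>* A\<close> contain superfluous
  zeros when there are more columns than rows, which does not affect the largest one.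
\<close>

definition spectral_norm :: "complex ^ 'c ^ 'r \<Rightarrow> real"
  where "spectral_norm A = (GREATEST s. singular_value A s)"

lemma inner_vec_complex: "inner (x :: complex ^ 'n) y = Re (\<Sum>i\<in>UNIV. x $ i * cnj (y $ i))"
  by (simp add: inner_vec_def inner_complex_def)

lemma cadjoint_cadjoint [simp]: "cadjoint (cadjoint A) = A"
  by (simp add: cadjoint_def vec_eq_iff)

lemma inner_cadjoint:
  fixes A :: "complex ^ 'c ^ 'r"
  shows "inner (A *v x) y = inner x (cadjoint A *v y)"
proof -
  have "(\<Sum>i\<in>UNIV. (A *v x) $ i * cnj (y $ i)) = (\<Sum>i\<in>UNIV. \<Sum>j\<in>UNIV. A $ i $ j * x $ j * cnj (y $ i))"
    by (simp add: matrix_vector_mult_def sum_distrib_right)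
  also have "\<dots> = (\<Sum>j\<in>UNIV. \<Sum>i\<in>UNIV. A $ i $ j * x $ j * cnj (y $ i))"
    by (rule sum.swap)
  also have "\<dots> = (\<Sum>j\<in>UNIV. x $ j * cnj ((cadjoint A *v y) $ j))"
    by (simp add: matrix_vector_mult_def cadjoint_def sum_distrib_left mult_ac)
  finally show ?thesis
    by (simp add: inner_vec_complex)
qed

lemma of_real_vector_smult: "complex_of_real c *s v = c *\<^sub>R v"
  by (simp add: vec_eq_iff) (simp add: scaleR_conv_of_real)

lemma bounded_linear_cmatrix: "bounded_linear ((*v) (A :: complex ^ 'c ^ 'r))"
proof -
  have "linear ((*v) A)"
  proof (rule linearI)
    show "A *v (x + y) = A *v x + A *v y" for x y
      by (rule matrix_vector_right_distrib)
    show "A *v (c *\<^sub>R x) = c *\<^sub>R (A *v x)" for c x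
      by (simp add: vec_eq_iff matrix_vector_mult_def scaleR_sum_right)
  qed
  then show ?thesis
    by (simp add: linear_conv_bounded_linear)
qed

lemma norm_cadjoint_le:
  fixes A :: "complex ^ 'c ^ 'r"
  shows "norm (cadjoint A *v y) \<le> onorm ((*v) A) * norm y"
proof (cases "cadjoint A *v y = 0")
  case True
  then show ?thesis
    using onorm_pos_le[OF bounded_linear_cmatrix, of A] by simp
next
  case False
  let ?z = "cadjoint A *v y"
  have "norm ?z * norm ?z = inner (A *v ?z) y"
    by (simp add: inner_cadjoint power2_norm_eq_inner[symmetric] power2_eq_square)
  also have "\<dots> \<le> norm (A *v ?z) * norm y"
    by (rule norm_cauchy_schwarz)
  also have "\<dots> \<le> (onorm ((*v) A) * norm ?z) * norm y"
    by (intro mult_right_mono onorm[OF bounded_linear_cmatrix]) auto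
  finally have "norm ?z * norm ?z \<le> (onorm ((*v) A) * norm y) * norm ?z"
    by (simp add: mult_ac)
  then show ?thesis
    using False by simp
qed

lemma singular_value_le_onorm:
  fixes A :: "complex ^ 'c ^ 'r"
  assumes "singular_value A s"
  shows "s \<le> onorm ((*v) A)"
proof -
  obtain v where v: "v \<noteq> 0" "cadjoint A *v (A *v v) = s\<^sup>2 *\<^sub>R v" and s: "0 \<le> s"
    using assms unfolding singular_value_def
    by (auto simp only: of_real_vector_smult matrix_vector_mul_assoc)
  have "(norm (A *v v))\<^sup>2 = inner v (cadjoint A *v (A *v v))"
    by (simp add: power2_norm_eq_inner inner_cadjoint)
  also have "\<dots> = (s * norm v)\<^sup>2"
    by (simp add: v power2_norm_eq_inner power_mult_distrib)
  finally have "norm (A *v v) = s * norm v"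
    using s by (simp add: power2_eq_iff_nonneg)
  then have "s * norm v \<le> onorm ((*v) A) * norm v"
    using onorm[OF bounded_linear_cmatrix, of A v] by simp
  then show ?thesis
    using v(1) by simp
qed

lemma singular_value_onorm:
  fixes A :: "complex ^ 'c ^ 'r"
  shows "singular_value A (onorm ((*v) A))"
proof -
  let ?s = "onorm ((*v) A)"
  have "compact (sphere (0 :: complex ^ 'c) 1)" "sphere (0 :: complex ^ 'c) 1 \<noteq> {}"
    by auto
  moreover have "continuous_on (sphere 0 1) (\<lambda>x. norm (A *v x))"
    by (intro continuous_on_norm linear_continuous_on bounded_linear_cmatrix)
  ultimately obtain v where v: "norm v = 1" and max: "\<And>x. norm x = 1 \<Longrightarrow> norm (A *v x) \<le> norm (A *v v)"
    using continuous_attains_sup[of "sphere (0 :: complex ^ 'c) 1" "\<lambda>x. norm (A *v x)"] by auto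
  have scale: "norm (A *v x) \<le> norm (A *v v) * norm x" for x
  proof (cases "x = 0")
    case False
    have "norm (A *v x) / norm x = norm (A *v (x /\<^sub>R norm x))"
      by (simp add: linear_scale[OF bounded_linear.linear[OF bounded_linear_cmatrix]] divide_inverse_commute)
    also have "\<dots> \<le> norm (A *v v)"
      using False by (intro max) simp
    finally show ?thesis
      using False by (simp add: field_simps)
  qed simp
  have s: "norm (A *v v) = ?s"
  proof (rule antisym)
    show "norm (A *v v) \<le> ?s"
      using onorm[OF bounded_linear_cmatrix, of A v] v by simp
    show "?s \<le> norm (A *v v)"
      by (rule onorm_bound) (use scale in auto)
  qed
  let ?w = "cadjoint A *v (A *v v)"
  have "inner ?w v = ?s\<^sup>2"
    using inner_cadjoint[of A v "A *v v"] by (simp add: inner_commute s[symmetric] power2_norm_eq_inner)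
  moreover have "(norm ?w)\<^sup>2 \<le> (?s * ?s)\<^sup>2"
    by (rule power_mono) (use norm_cadjoint_le[of A "A *v v"] s in auto)
  moreover have "(norm (?w - ?s\<^sup>2 *\<^sub>R v))\<^sup>2 = (norm ?w)\<^sup>2 - 2 * ?s\<^sup>2 * inner ?w v + (?s\<^sup>2)\<^sup>2 * (norm v)\<^sup>2"
    unfolding power2_norm_eq_inner
    by (simp add: inner_diff_left inner_diff_right inner_commute power2_eq_square algebra_simps)
  ultimately have "(norm (?w - ?s\<^sup>2 *\<^sub>R v))\<^sup>2 \<le> 0"
    using v by (simp add: power2_eq_square algebra_simps)
  then have "?w = ?s\<^sup>2 *\<^sub>R v"
    by simp
  moreover have "v \<noteq> 0"
    using v by auto
  ultimately show ?thesis
    unfolding singular_value_def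
    by (auto simp only: of_real_vector_smult matrix_vector_mul_assoc[symmetric]
        intro!: onorm_pos_le[OF bounded_linear_cmatrix])
qed

lemma spectral_norm_eq_onorm: "spectral_norm A = onorm ((*v) A)"
  unfolding spectral_norm_def
  by (rule Greatest_equality) (auto intro: singular_value_onorm singular_value_le_onorm)

text \<open>
  The conditional expectation of a random matrix is taken entrywise, with the real and
  imaginary parts treated separately. As usual it is determined only almost surely;
  \<^const>\<open>real_cond_exp\<close> selects a version.
\<close>

definition matrix_cond_exp ::
  "'a measure \<Rightarrow> 'a measure \<Rightarrow> ('a \<Rightarrow> complex ^ 'c ^ 'r) \<Rightarrow> 'a \<Rightarrow> complex ^ 'c ^ 'r"
  where "matrix_cond_exp M G Z \<omega> =
    (\<chi> i j. Complex (real_cond_exp M G (\<lambda>\<omega>. Re (Z \<omega> $ i $ j)) \<omega>)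
                    (real_cond_exp M G (\<lambda>\<omega>. Im (Z \<omega> $ i $ j)) \<omega>))"

text \<open>
  The last clause is the standing convention that martingales are null at time zero; like the
  martingale identity it is required almost surely. Integrability of \<open>Y 0\<close> then follows.
\<close>

definition matrix_martingale ::
  "'a measure \<Rightarrow> (nat \<Rightarrow> 'a measure) \<Rightarrow> (nat \<Rightarrow> 'a \<Rightarrow> complex ^ 'c ^ 'r) \<Rightarrow> bool"
  where "matrix_martingale M F Y \<longleftrightarrow>
    (\<forall>k. Y k \<in> borel_measurable (F k)) \<and>
    (\<forall>k\<ge>1. AE \<omega> in M. matrix_cond_exp M (F (k - 1)) (Y k) \<omega> = Y (k - 1) \<omega>) \<and>
    (\<forall>k\<ge>1. integrable M (\<lambda>\<omega>. spectral_norm (Y k \<omega>))) \<and>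
    (AE \<omega> in M. Y 0 \<omega> = 0)"

text \<open>
  The difference sequence is used for \<open>k \<ge> 1\<close> only: since subtraction on natural numbers is
  truncated, its value at \<open>k = 0\<close> is meaningless.
\<close>

definition difference_sequence ::
  "(nat \<Rightarrow> 'a \<Rightarrow> complex ^ 'c ^ 'r) \<Rightarrow> nat \<Rightarrow> 'a \<Rightarrow> complex ^ 'c ^ 'r"
  where "difference_sequence Y k \<omega> = Y k \<omega> - Y (k - 1) \<omega>"

definition W_col ::
  "'a measure \<Rightarrow> (nat \<Rightarrow> 'a measure) \<Rightarrow> (nat \<Rightarrow> 'a \<Rightarrow> complex ^ 'c ^ 'r) \<Rightarrow> nat \<Rightarrow> 'a \<Rightarrow> complex ^ 'r ^ 'r"
  where "W_col M F Y k \<omega> = (\<Sum>j=1..k. matrix_cond_exp M (F (j - 1))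
    (\<lambda>\<omega>. difference_sequence Y j \<omega> ** cadjoint (difference_sequence Y j \<omega>)) \<omega>)"

definition W_row ::
  "'a measure \<Rightarrow> (nat \<Rightarrow> 'a measure) \<Rightarrow> (nat \<Rightarrow> 'a \<Rightarrow> complex ^ 'c ^ 'r) \<Rightarrow> nat \<Rightarrow> 'a \<Rightarrow> complex ^ 'c ^ 'c"
  where "W_row M F Y k \<omega> = (\<Sum>j=1..k. matrix_cond_exp M (F (j - 1))
    (\<lambda>\<omega>. cadjoint (difference_sequence Y j \<omega>) ** difference_sequence Y j \<omega>) \<omega>)"

end

theory Submission
  imports Defs
begin

text \<open>
  Write \<open>D(Y)\<close> for the Hermitian dilation of \<open>Y\<close> and \<open>W\<^sub>k\<close> for the block diagonal operator with blocks
  \<open>W_col\<close> and \<open>W_row\<close> at time \<open>k\<close>. For \<open>\<theta> R < 3\<close> and \<open>g = \<theta>\<^sup>2 / (2 (1 - \<theta> R / 3))\<close> the process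
  \<open>tr exp (\<theta> D(Y\<^sub>k) - g W\<^sub>k)\<close> is a positive supermartingale starting at the real dimension
  \<open>2 (d1 + d2)\<close>. On the event in question it is at least \<open>2 exp (\<theta> t - g \<sigma>\<^sup>2)\<close>, so the bound follows by stopping and the choice
  \<open>\<theta> = t / (\<sigma>\<^sup>2 + R t / 3)\<close>.

  The supermartingale property does not need Lieb's concavity theorem. With the predictable
  \<open>H = \<theta> D(Y\<^sub>k\<^sub>-\<^sub>1) - g W\<^sub>k\<close> and \<open>V = W\<^sub>k - W\<^sub>k\<^sub>-\<^sub>1\<close>, the Golden-Thompson inequality reduces the conditional
  expectation to that of \<open>tr (exp H \<cdot> exp (\<theta> D(X\<^sub>k)))\<close>, which is at most \<open>tr (exp H \<cdot> (1 + g V))\<close>, and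
  convexity of \<open>tr exp\<close> bounds this by \<open>tr exp (H + g V)\<close>.
\<close>

section \<open>The Banach algebra of operators on a Euclidean space\<close>

text \<open>A separate type is used because a class instance for
  \<open>'a \<Rightarrow>\<^sub>L 'b\<close> cannot be restricted to equal domain and codomain. With
  composition as multiplication it becomes a Banach algebra, so that powers and the generic
  \<open>exp\<close> are available.\<close>

typedef (overloaded) 'a endo = "UNIV :: ('a::euclidean_space \<Rightarrow>\<^sub>L 'a) set"
  morphisms blinfun_of_endo Endo
  by simp

setup_lifting type_definition_endo

lift_definition endo_apply :: "'a::euclidean_space endo \<Rightarrow> 'a \<Rightarrow> 'a" (infixr "$$" 85) is blinfun_apply .

lemma endo_eqI: "(\<And>x. A $$ x = B $$ x) \<Longrightarrow> A = B"
  by transfer (rule blinfun_eqI)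

lemma bounded_linear_endo_apply: "bounded_linear (($$) A)"
  by transfer (rule blinfun.bounded_linear_right)

lemma endo_apply_scaleR_right: "A $$ (c *\<^sub>R x) = c *\<^sub>R (A $$ x)"
  by (rule linear_scale[OF bounded_linear.linear[OF bounded_linear_endo_apply]])

definition to_endo :: "('a::euclidean_space \<Rightarrow> 'a) \<Rightarrow> 'a endo"
  where "to_endo f = Endo (Blinfun f)"

lemma to_endo_apply [simp]: "linear f \<Longrightarrow> to_endo f $$ x = f x"
  by (simp add: to_endo_def endo_apply_def Endo_inverse bounded_linear_Blinfun_apply
      linear_conv_bounded_linear)

instantiation endo :: (euclidean_space) "{real_normed_vector, ring_1}"
begin

lift_definition norm_endo :: "'a endo \<Rightarrow> real" is norm .
lift_definition minus_endo :: "'a endo \<Rightarrow> 'a endo \<Rightarrow> 'a endo" is minus .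
lift_definition plus_endo :: "'a endo \<Rightarrow> 'a endo \<Rightarrow> 'a endo" is plus .
lift_definition uminus_endo :: "'a endo \<Rightarrow> 'a endo" is uminus .
lift_definition zero_endo :: "'a endo" is 0 .
lift_definition one_endo :: "'a endo" is id_blinfun .
lift_definition times_endo :: "'a endo \<Rightarrow> 'a endo \<Rightarrow> 'a endo" is blinfun_compose .
lift_definition scaleR_endo :: "real \<Rightarrow> 'a endo \<Rightarrow> 'a endo" is scaleR .

definition dist_endo :: "'a endo \<Rightarrow> 'a endo \<Rightarrow> real"
  where "dist_endo A B = norm (A - B)"

definition "(uniformity :: ('a endo \<times> 'a endo) filter) =
  (INF e\<in>{0 <..}. principal {(x, y). dist x y < e})"

definition open_endo :: "'a endo set \<Rightarrow> bool"
  where "open_endo S = (\<forall>x\<in>S. \<forall>\<^sub>F (x', y) in uniformity. x' = x \<longrightarrow> y \<in> S)"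

definition sgn_endo :: "'a endo \<Rightarrow> 'a endo"
  where "sgn_endo A = inverse (norm A) *\<^sub>R A"

instance
proof
  show "(0::'a endo) \<noteq> 1"
  proof
    assume "(0::'a endo) = 1"
    then have "(0 :: 'a \<Rightarrow>\<^sub>L 'a) = id_blinfun"
      by transfer
    then have "blinfun_apply (0 :: 'a \<Rightarrow>\<^sub>L 'a) x = x" for x
      by (metis blinfun_apply_id_blinfun)
    then have "(SOME b. b \<in> Basis) = (0 :: 'a)"
      by simp
    then show False
      by (metis SOME_Basis nonzero_Basis)
  qed
qed (simp_all add: dist_endo_def uniformity_endo_def open_endo_def sgn_endo_def,
    (transfer, auto simp: norm_triangle_ineq scaleR_add_right scaleR_add_left
      blinfun.bilinear_simps intro!: blinfun_eqI)+)

end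

lemma endo_apply_simps [simp]:
  "(A + B) $$ x = A $$ x + B $$ x" "(A - B) $$ x = A $$ x - B $$ x" "(- A) $$ x = - (A $$ x)"
  "0 $$ x = 0" "1 $$ x = x" "(A * B) $$ x = A $$ (B $$ x)" "(c *\<^sub>R A) $$ x = c *\<^sub>R (A $$ x)"
  by (transfer, simp add: blinfun.bilinear_simps)+

instance endo :: (euclidean_space) real_normed_algebra_1
proof
  fix A B :: "'a endo"
  show "a *\<^sub>R A * B = a *\<^sub>R (A * B)" "A * a *\<^sub>R B = a *\<^sub>R (A * B)" for a
    by (rule endo_eqI; simp add: endo_apply_scaleR_right)+
  show "norm (A * B) \<le> norm A * norm B"
    by transfer (rule norm_blinfun_compose)
  show "norm (1 :: 'a endo) = 1"
    by transfer simp
qed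

instance endo :: (euclidean_space) banach
proof
  fix X :: "nat \<Rightarrow> 'a endo"
  assume "Cauchy X"
  then have "Cauchy (\<lambda>n. blinfun_of_endo (X n))"
    by (simp add: Cauchy_def dist_norm norm_endo.rep_eq minus_endo.rep_eq)
  then obtain L where "(\<lambda>n. blinfun_of_endo (X n)) \<longlonglongrightarrow> L"
    by (auto simp: Cauchy_convergent_iff convergent_def)
  then have "X \<longlonglongrightarrow> Endo L"
    by (simp add: LIMSEQ_def dist_norm norm_endo.rep_eq minus_endo.rep_eq Endo_inverse)
  then show "convergent X"
    by (auto simp: convergent_def)
qed

lemma norm_endo_apply: "norm (A $$ x) \<le> norm A * norm x"
  by transfer (rule norm_blinfun)

lemma norm_endo_bound: "0 \<le> b \<Longrightarrow> (\<And>x. norm (A $$ x) \<le> b * norm x) \<Longrightarrow> norm A \<le> b"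
  by transfer (rule norm_blinfun_bound)

lemma bounded_linear_endo_eval: "bounded_linear (\<lambda>A. A $$ x)"
  by (rule bounded_linear_intro[where K = "norm x"])
    (auto simp: norm_endo_apply)

section \<open>Adjoints and the real trace\<close>

definition adj :: "'a::euclidean_space endo \<Rightarrow> 'a endo"
  where "adj A = to_endo (adjoint (($$) A))"

lemma inner_adj: "x \<bullet> adj A $$ y = A $$ x \<bullet> y"
  by (simp add: adj_def adjoint_linear adjoint_works bounded_linear.linear bounded_linear_endo_apply)

lemma inner_adj': "adj A $$ y \<bullet> x = y \<bullet> A $$ x"
  by (metis inner_adj inner_commute)

lemma adj_eqI:
  assumes "\<And>x y. x \<bullet> B $$ y = A $$ x \<bullet> y"
  shows "adj A = B"
  by (rule endo_eqI, rule vector_eq_ldot[THEN iffD1]) (simp add: assms inner_adj)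

lemma adj_simps [simp]:
  "adj (A + B) = adj A + adj B" "adj (A - B) = adj A - adj B" "adj (- A) = - adj A"
  "adj 1 = 1" "adj 0 = 0" "adj (A * B) = adj B * adj A" "adj (c *\<^sub>R A) = c *\<^sub>R adj A"
  "adj (adj A) = A"
  by (rule adj_eqI; simp add: inner_simps inner_adj inner_adj')+

lemma adj_power [simp]: "adj (A ^ n) = adj A ^ n"
  by (induction n) (simp_all add: power_commutes)

text \<open>The square of \<open>norm (adj A $$ x)\<close> equals
  \<open>A $$ (adj A $$ x) \<bullet> x\<close>; Cauchy-Schwarz bounds this, and one factor cancels.
  Boundedness lets \<open>adj\<close> pass through the exponential series.\<close>

lemma bounded_linear_adj: "bounded_linear adj"
proof (rule bounded_linear_intro[where K = 1])
  fix A :: "'a endo"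
  have "norm (adj A) \<le> norm A"
  proof (rule norm_endo_bound)
    fix x
    have "norm (adj A $$ x) * norm (adj A $$ x) = A $$ (adj A $$ x) \<bullet> x"
      by (metis inner_adj power2_eq_square power2_norm_eq_inner)
    also have "\<dots> \<le> (norm A * norm (adj A $$ x)) * norm x"
      by (intro order_trans[OF norm_cauchy_schwarz] mult_right_mono norm_endo_apply) simp
    finally have "norm (adj A $$ x) * norm (adj A $$ x) \<le> (norm A * norm x) * norm (adj A $$ x)"
      by (simp add: mult_ac)
    then show "norm (adj A $$ x) \<le> norm A * norm x"
      by (cases "adj A $$ x = 0") auto
  qed simp
  then show "norm (adj A) \<le> norm A * 1"
    by simp
qed simp_all

lemma adj_exp: "adj (exp A) = exp (adj A)"
proof -
  have "(\<lambda>n. adj (A ^ n /\<^sub>R fact n)) sums adj (exp A)"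
    by (rule bounded_linear.sums[OF bounded_linear_adj exp_converges])
  then show ?thesis
    using sums_unique2[OF _ exp_converges] by simp
qed

text \<open>
  A complex linear operator is traced over the reals, which counts every eigenvalue twice, once for
  an eigenvector and once for its multiple by the imaginary unit. The doubling appears on both sides
  of the final estimate and cancels.
\<close>

definition tr :: "'a::euclidean_space endo \<Rightarrow> real"
  where "tr A = (\<Sum>b\<in>Basis. b \<bullet> A $$ b)"

lemma tr_simps:
  "tr (A + B) = tr A + tr B" "tr (A - B) = tr A - tr B" "tr (- A) = - tr A" "tr 0 = 0"
  "tr (c *\<^sub>R A) = c * tr A"
  by (simp_all add: tr_def inner_simps sum.distrib sum_subtractf sum_negf sum_distrib_left)

lemma tr_one: "tr (1 :: 'a::euclidean_space endo) = DIM('a)"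
  by (simp add: tr_def inner_same_Basis)

lemma bounded_linear_tr: "bounded_linear tr"
  unfolding tr_def
  by (intro bounded_linear_sum bounded_linear_inner_right_comp bounded_linear_endo_eval)

lemma tr_adj: "tr (adj A) = tr A"
  by (simp add: tr_def inner_adj inner_commute)

lemma tr_adj_mult: "tr (adj A * B) = (\<Sum>b\<in>Basis. A $$ b \<bullet> B $$ b)"
  by (simp add: tr_def inner_adj)

text \<open>\<open>tr (adj A * B)\<close> is the Hilbert-Schmidt inner product. Expanding in
  coordinates and swapping the sums replaces both operators by their adjoints; cyclicity of the
  trace follows.\<close>

lemma tr_adj_mult_commute: "tr (adj A * B) = tr (B * adj A)"
proof -
  have "tr (adj A * B) = (\<Sum>b\<in>Basis. \<Sum>c\<in>Basis. (A $$ b \<bullet> c) * (B $$ b \<bullet> c))"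
    by (simp add: tr_adj_mult euclidean_inner[of "A $$ _" "B $$ _"])
  also have "\<dots> = (\<Sum>c\<in>Basis. \<Sum>b\<in>Basis. (adj A $$ c \<bullet> b) * (adj B $$ c \<bullet> b))"
    by (subst sum.swap) (simp only: inner_adj' inner_commute[of _ "_ $$ _"])
  also have "\<dots> = tr (adj (adj B) * adj A)"
    unfolding tr_adj_mult by (simp add: euclidean_inner[of "adj B $$ _" "adj A $$ _"] mult.commute)
  finally show ?thesis
    by simp
qed

lemma tr_commute: "tr (A * B) = tr (B * A)"
  using tr_adj_mult_commute[of "adj A" B] by simp

lemma tr_adj_self_nonneg: "0 \<le> tr (adj A * A)"
  by (simp add: tr_adj_mult sum_nonneg)

text \<open>Expanding the nonnegative squared Hilbert-Schmidt norm of \<open>adj A - B\<close> gives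
  this additive form of the Cauchy-Schwarz inequality.\<close>

lemma tr_mult_le: "2 * tr (A * B) \<le> tr (A * adj A) + tr (adj B * B)"
proof -
  have "tr (adj (adj A - B) * (adj A - B)) = tr (A * adj A) + tr (adj B * B) - (tr (A * B) + tr (adj (A * B)))"
    by (simp add: tr_simps algebra_simps)
  then show ?thesis
    using tr_adj_self_nonneg[of "adj A - B"] by (simp add: tr_adj del: adj_simps)
qed

section \<open>Trace inequalities for the exponential\<close>

lemma norm_power_diff_le:
  fixes X Y :: "'a::real_normed_algebra_1"
  assumes "norm X \<le> K" "norm Y \<le> K"
  shows "norm (X ^ Suc n - Y ^ Suc n) \<le> real (Suc n) * K ^ n * norm (X - Y)"
proof (induction n)
  case (Suc n)
  have K: "0 \<le> K"
    using assms(1) norm_ge_zero order_trans by blast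
  \<comment> \<open>Telescoping one factor at a time preserves the order of the factors, since
    \<open>X\<close> and \<open>Y\<close> need not commute.\<close>
  have "X ^ Suc (Suc n) - Y ^ Suc (Suc n) = X * (X ^ Suc n - Y ^ Suc n) + (X - Y) * Y ^ Suc n"
    by (simp add: algebra_simps)
  also have "norm \<dots> \<le> norm X * norm (X ^ Suc n - Y ^ Suc n) + norm (X - Y) * norm (Y ^ Suc n)"
    by (intro norm_triangle_mono norm_mult_ineq)
  also have "\<dots> \<le> K * (real (Suc n) * K ^ n * norm (X - Y)) + norm (X - Y) * K ^ Suc n"
    using K assms Suc.IH
    by (intro add_mono mult_mono order_trans[OF norm_power_ineq] power_mono) auto
  also have "\<dots> = real (Suc (Suc n)) * K ^ Suc n * norm (X - Y)"
    by (simp add: algebra_simps)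
  finally show ?case .
qed simp

lemma norm_exp_diff_le:
  fixes X Y :: "'a::{real_normed_algebra_1,banach}"
  assumes "norm X \<le> K" "norm Y \<le> K"
  shows "norm (exp X - exp Y) \<le> exp K * norm (X - Y)"
proof -
  \<comment> \<open>The terms of index 0 cancel, and at index \<open>m + 1\<close> the factor
    \<open>m + 1\<close> reduces \<open>fact (m + 1)\<close> to \<open>fact m\<close>. Hence the
    majorant is the series of \<open>exp K\<close> shifted by one.\<close>
  define g where "g n = (case n of 0 \<Rightarrow> 0 | Suc n \<Rightarrow> K ^ n /\<^sub>R fact n * norm (X - Y))" for n
  have "(\<lambda>n. X ^ n /\<^sub>R fact n - Y ^ n /\<^sub>R fact n) sums (exp X - exp Y)"
    by (intro sums_diff exp_converges)
  moreover have "(\<lambda>n. g (Suc n)) sums (exp K * norm (X - Y))"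
    unfolding g_def nat.case by (intro sums_mult2 exp_converges)
  then have "g sums (exp K * norm (X - Y))"
    by (subst (asm) sums_Suc_iff) (simp add: g_def)
  moreover have "norm (X ^ n /\<^sub>R fact n - Y ^ n /\<^sub>R fact n) \<le> g n" for n
  proof (cases n)
    case (Suc m)
    have "norm (X ^ n /\<^sub>R fact n - Y ^ n /\<^sub>R fact n) = norm (X ^ Suc m - Y ^ Suc m) / fact (Suc m)"
      by (simp add: Suc scaleR_diff_right[symmetric] divide_inverse_commute del: fact_Suc power_Suc)
    also have "\<dots> \<le> real (Suc m) * K ^ m * norm (X - Y) / fact (Suc m)"
      by (intro divide_right_mono norm_power_diff_le assms) simp
    also have "\<dots> = g n"
      by (simp add: g_def Suc field_simps del: of_nat_Suc)
    finally show ?thesis .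
  qed (simp add: g_def)
  ultimately show ?thesis
    by (rule norm_sums_le)
qed

lemma continuous_on_exp_algebra:
  fixes f :: "'b::topological_space \<Rightarrow> 'a::{real_normed_algebra_1,banach}"
  assumes "continuous_on S f"
  shows "continuous_on S (\<lambda>x. exp (f x))"
proof -
  have "isCont exp A" for A :: 'a
    unfolding isCont_def
  proof (rule LIM_I)
    fix e :: real
    assume e: "e > 0"
    let ?K = "norm A + 1"
    show "\<exists>d>0. \<forall>B. B \<noteq> A \<and> norm (B - A) < d \<longrightarrow> norm (exp B - exp A) < e"
    proof (intro exI[of _ "min 1 (e / exp ?K)"] conjI allI impI)
      fix B
      assume B: "B \<noteq> A \<and> norm (B - A) < min 1 (e / exp ?K)"
      then have "norm B \<le> ?K"
        using norm_triangle_sub[of B A] by simp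
      then have "norm (exp B - exp A) \<le> exp ?K * norm (B - A)"
        by (rule norm_exp_diff_le) simp
      also have "\<dots> < e"
        using B by (simp add: field_simps)
      finally show "norm (exp B - exp A) < e" .
    qed (use e in simp)
  qed
  then have "continuous_on UNIV (exp :: 'a \<Rightarrow> 'a)"
    by (simp add: continuous_on_eq_continuous_at)
  from continuous_on_compose2[OF this assms] show ?thesis
    by simp
qed

lemma exp_power_eq: "exp X ^ n = exp (real n *\<^sub>R X)"
  for X :: "'a::{real_normed_algebra_1,banach}"
proof (induction n)
  case (Suc n)
  have "real (Suc n) *\<^sub>R X = X + real n *\<^sub>R X"
    by (simp add: algebra_simps)
  then show ?case
    by (simp add: Suc exp_add_commuting)
qed simp

lemma exp_half_mult: "exp ((1 / 2) *\<^sub>R X) * exp ((1 / 2) *\<^sub>R X) = exp X"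
  for X :: "'a::{real_normed_algebra_1,banach}"
  using exp_power_eq[of "(1 / 2) *\<^sub>R X" 2] by (simp add: power2_eq_square)

text \<open>Dyadic points match the powers \<open>2 ^ n\<close> in the Lie-Trotter formula and the
  repeated halving under midpoint convexity.\<close>

lemma has_vector_derivative_dyadic:
  assumes "(f has_vector_derivative D) (at 0)"
  shows "(\<lambda>n. 2 ^ n *\<^sub>R (f (1 / 2 ^ n) - f 0)) \<longlonglongrightarrow> D"
proof -
  have "((\<lambda>h. norm (f (0 + h) - f 0 - h *\<^sub>R D) / norm h) \<longlongrightarrow> 0) (at 0)"
    using assms by (simp add: has_vector_derivative_def has_derivative_at)
  moreover have "filterlim (\<lambda>n. 1 / 2 ^ n :: real) (at 0) sequentially"
    by (auto simp: filterlim_at intro: LIMSEQ_divide_realpow_zero)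
  ultimately have "(\<lambda>n. norm (f (0 + 1 / 2 ^ n) - f 0 - (1 / 2 ^ n) *\<^sub>R D) / norm (1 / 2 ^ n :: real)) \<longlonglongrightarrow> 0"
    by (rule filterlim_compose)
  moreover have "norm (f (0 + 1 / 2 ^ n) - f 0 - (1 / 2 ^ n) *\<^sub>R D) / norm (1 / 2 ^ n :: real) =
      norm (2 ^ n *\<^sub>R (f (1 / 2 ^ n) - f 0) - D)" for n
  proof -
    have "2 ^ n *\<^sub>R (f (1 / 2 ^ n) - f 0) - D = 2 ^ n *\<^sub>R (f (0 + 1 / 2 ^ n) - f 0 - (1 / 2 ^ n) *\<^sub>R D)"
      by (simp add: scaleR_diff_right)
    then show ?thesis
      by (simp add: mult.commute)
  qed
  ultimately show ?thesis
    by (subst LIM_zero_iff[symmetric], subst tendsto_norm_zero_iff[symmetric]) simp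
qed

text \<open>\<open>T n\<close> and \<open>S n\<close> in the proof agree to first order in
  \<open>1 / 2 ^ n\<close>, so \<open>2 ^ n\<close> times their difference tends to 0. Raising both
  to the power \<open>2 ^ n\<close> multiplies the error by at most \<open>2 ^ n\<close> times a
  constant.\<close>

lemma exp_Lie_Trotter:
  fixes A B :: "'a::{real_normed_algebra_1,banach}"
  shows "(\<lambda>n. (exp (A /\<^sub>R 2 ^ n) * exp (B /\<^sub>R 2 ^ n)) ^ (2 ^ n)) \<longlonglongrightarrow> exp (A + B)"
proof -
  let ?f = "\<lambda>t::real. exp (t *\<^sub>R A) * exp (t *\<^sub>R B) - exp (t *\<^sub>R (A + B))"
  define S T where "S n = exp ((A + B) /\<^sub>R 2 ^ n)" and "T n = exp (A /\<^sub>R 2 ^ n) * exp (B /\<^sub>R 2 ^ n)" for n :: nat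
  define K where "K n = exp ((norm A + norm B) / 2 ^ n)" for n :: nat
  have "(?f has_vector_derivative
      exp (0 *\<^sub>R A) * (exp (0 *\<^sub>R B) * B) + exp (0 *\<^sub>R A) * A * exp (0 *\<^sub>R B) - exp (0 *\<^sub>R (A + B)) * (A + B)) (at 0)"
    by (intro has_vector_derivative_diff has_vector_derivative_mult exp_scaleR_has_vector_derivative_right)
  then have "(\<lambda>n. 2 ^ n *\<^sub>R (?f (1 / 2 ^ n) - ?f 0)) \<longlonglongrightarrow> 0"
    by (intro has_vector_derivative_dyadic) (simp add: add.commute)
  then have "(\<lambda>n. 2 ^ n *\<^sub>R (T n - S n)) \<longlonglongrightarrow> 0"
    by (simp add: S_def T_def divide_inverse)
  then have lim: "(\<lambda>n. exp (norm A + norm B) * norm (2 ^ n *\<^sub>R (T n - S n))) \<longlonglongrightarrow> 0"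
    by (intro tendsto_mult_right_zero tendsto_norm_zero)
  have "(\<lambda>n. T n ^ 2 ^ n - exp (A + B)) \<longlonglongrightarrow> 0"
  proof (rule tendsto_0_le[OF lim, where K = 1], intro eventuallyI)
    fix n
    obtain m where m: "2 ^ n = Suc m"
      by (metis not0_implies_Suc power_eq_0_iff zero_neq_numeral)
    have "exp (A + B) = S n ^ 2 ^ n"
      by (simp add: S_def exp_power_eq)
    moreover have "norm (T n ^ Suc m - S n ^ Suc m) \<le> real (Suc m) * K n ^ m * norm (T n - S n)"
    proof (rule norm_power_diff_le)
      have "norm (T n) \<le> exp (norm (A /\<^sub>R 2 ^ n)) * exp (norm (B /\<^sub>R 2 ^ n))"
        unfolding T_def by (intro order_trans[OF norm_mult_ineq] mult_mono norm_exp) auto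
      then show "norm (T n) \<le> K n"
        by (simp add: K_def add_divide_distrib exp_add divide_inverse_commute distrib_left)
      show "norm (S n) \<le> K n"
        unfolding S_def K_def
        by (rule order_trans[OF norm_exp]) (simp add: divide_inverse_commute norm_triangle_ineq)
    qed
    \<comment> \<open>This makes the constant independent of \<open>n\<close>: the full power
      \<open>K n ^ (2 ^ n)\<close> is exactly \<open>exp (norm A + norm B)\<close>.\<close>
    moreover have "K n ^ m \<le> exp (norm A + norm B)"
    proof -
      have "K n ^ m \<le> K n ^ (2 ^ n)"
        by (intro power_increasing) (simp_all add: K_def m)
      also have "\<dots> = exp (norm A + norm B)"
        by (simp add: K_def flip: exp_of_nat_mult)
      finally show ?thesis .
    qed
    then have "real (Suc m) * K n ^ m * norm (T n - S n) \<le> real (Suc m) * exp (norm A + norm B) * norm (T n - S n)"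
      by (intro mult_right_mono mult_left_mono) auto
    moreover have "real (Suc m) = 2 ^ n"
      by (metis m of_nat_numeral of_nat_power)
    ultimately have "norm (T n ^ 2 ^ n - exp (A + B)) \<le> 2 ^ n * exp (norm A + norm B) * norm (T n - S n)"
      unfolding m by (simp only: mult.assoc)
    then show "norm (T n ^ 2 ^ n - exp (A + B)) \<le> norm (exp (norm A + norm B) * norm (2 ^ n *\<^sub>R (T n - S n))) * 1"
      by (simp add: mult_ac)
  qed
  then show ?thesis
    by (simp add: LIM_zero_iff T_def)
qed

section \<open>The Golden-Thompson inequality along powers of two\<close>

lemma tr_power_commute: "tr ((A * B) ^ n) = tr ((B * A) ^ n)"
proof (cases n)
  case (Suc m)
  have shift: "(A * B) ^ m * A = A * (B * A) ^ m"
    by (induction m) (simp_all add: mult.assoc)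
  have "tr ((A * B) ^ n) = tr ((A * B) ^ m * A * B)"
    by (simp add: Suc power_commutes mult.assoc flip: power_Suc2)
  also have "\<dots> = tr ((B * A) ^ n)"
    by (simp add: shift Suc mult.assoc tr_commute[of A])  (simp add: power_commutes mult.assoc)
  finally show ?thesis .
qed simp

text \<open>
  Both halves are needed for the induction: the first one for \<open>X\<^sup>2\<close> leads to a power of the product
  of \<open>X\<^sup>* X\<close> and \<open>X X\<^sup>*\<close>, which the second one controls.
\<close>

lemma tr_power_le:
  fixes P Q X :: "'a::euclidean_space endo"
  shows "tr (X ^ 2 ^ Suc k) \<le> tr ((X * adj X) ^ 2 ^ k) \<and>
   (adj P = P \<longrightarrow> adj Q = Q \<longrightarrow> tr ((P * Q) ^ 2 ^ k) \<le> tr (P ^ 2 ^ k * Q ^ 2 ^ k))"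
proof (induction k arbitrary: X P Q)
  case 0
  have "2 * tr (X * X) \<le> tr (X * adj X) + tr (adj X * X)"
    by (rule tr_mult_le)
  then show ?case
    by (simp add: power2_eq_square tr_adj_mult_commute)
next
  case (Suc k)
  have sq: "(Z ^ 2) ^ 2 ^ k = Z ^ 2 ^ Suc k" "Z ^ 2 ^ k * Z ^ 2 ^ k = Z ^ 2 ^ Suc k" for Z :: "'a endo"
    by (simp_all add: mult_2 flip: power_mult power_add)
  let ?P = "adj X * X" and ?Q = "X * adj X"
  have "tr (X ^ 2 ^ Suc (Suc k)) = tr ((X ^ 2) ^ 2 ^ Suc k)"
    by (simp flip: power_mult)
  also have "\<dots> \<le> tr ((X ^ 2 * adj (X ^ 2)) ^ 2 ^ k)"
    using Suc.IH by blast
  also have "\<dots> = tr ((?P * ?Q) ^ 2 ^ k)"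
    using tr_power_commute[of "X * X * adj X" "adj X" "2 ^ k"] by (simp add: power2_eq_square mult.assoc)
  also have "\<dots> \<le> tr (?P ^ 2 ^ k * ?Q ^ 2 ^ k)"
    using Suc.IH[of X ?P ?Q] by simp
  also have "\<dots> \<le> (tr (?P ^ 2 ^ Suc k) + tr (?Q ^ 2 ^ Suc k)) / 2"
    using tr_mult_le[of "?P ^ 2 ^ k" "?Q ^ 2 ^ k"] by (simp add: sq del: power_Suc)
  also have "\<dots> = tr (?Q ^ 2 ^ Suc k)"
    using tr_power_commute[of "adj X" X "2 ^ Suc k"] by simp
  finally have "tr (X ^ 2 ^ Suc (Suc k)) \<le> tr ((X * adj X) ^ 2 ^ Suc k)" .
  moreover have "tr ((P * Q) ^ 2 ^ Suc k) \<le> tr (P ^ 2 ^ Suc k * Q ^ 2 ^ Suc k)" if "adj P = P" "adj Q = Q"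
  proof -
    \<comment> \<open>The first half of the induction hypothesis, taken at \<open>P * Q\<close>,
      produces \<open>P * Q * Q * P\<close>. Cyclic rotation under the power turns it into
      \<open>P ^ 2 * Q ^ 2\<close>, where the second half applies.\<close>
    have "tr ((P * Q) ^ 2 ^ Suc k) \<le> tr ((P * Q * adj (P * Q)) ^ 2 ^ k)"
      using Suc.IH by blast
    also have "\<dots> = tr ((P ^ 2 * Q ^ 2) ^ 2 ^ k)"
      using tr_power_commute[of P "Q * Q * P" "2 ^ k"] tr_power_commute[of "P * P" "Q * Q" "2 ^ k"] that
      by (simp add: power2_eq_square mult.assoc)
    also have "\<dots> \<le> tr ((P ^ 2) ^ 2 ^ k * (Q ^ 2) ^ 2 ^ k)"
      using Suc.IH[of X "P ^ 2" "Q ^ 2"] that by simp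
    finally show ?thesis
      by (simp only: sq)
  qed
  ultimately show ?case
    by blast
qed

text \<open>\<open>tr_power_le\<close> for the exponentials of \<open>A /\<^sub>R 2 ^ n\<close> and
  \<open>B /\<^sub>R 2 ^ n\<close> has a right-hand side that does not depend on \<open>n\<close>;
  the left-hand side converges by the Lie-Trotter formula.\<close>

lemma golden_thompson:
  assumes "adj A = A" "adj B = B"
  shows "tr (exp (A + B)) \<le> tr (exp A * exp B)"
proof (rule LIMSEQ_le_const2)
  show "(\<lambda>n. tr ((exp (A /\<^sub>R 2 ^ n) * exp (B /\<^sub>R 2 ^ n)) ^ (2 ^ n))) \<longlonglongrightarrow> tr (exp (A + B))"
    by (rule bounded_linear.tendsto[OF bounded_linear_tr exp_Lie_Trotter])
  have "tr ((exp (A /\<^sub>R 2 ^ n) * exp (B /\<^sub>R 2 ^ n)) ^ 2 ^ n) \<le> tr (exp A * exp B)" for n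
    using tr_power_le[THEN conjunct2, of "exp (A /\<^sub>R 2 ^ n)" "exp (B /\<^sub>R 2 ^ n)" n] assms
    by (simp add: adj_exp exp_power_eq)
  then show "\<exists>N. \<forall>n\<ge>N. tr ((exp (A /\<^sub>R 2 ^ n) * exp (B /\<^sub>R 2 ^ n)) ^ 2 ^ n) \<le> tr (exp A * exp B)"
    by blast
qed

text \<open>Midpoint convexity towards 0 makes the dyadic difference quotients decrease in
  \<open>n\<close>, so all of them are at most \<open>f 1 - f 0\<close>. A lower bound
  \<open>h\<close> with a known limit stands in for the derivative of \<open>f\<close>.\<close>

lemma midpoint_convex_ge_tangent:
  fixes f h :: "real \<Rightarrow> real"
  assumes mid: "\<And>s. f (s / 2) \<le> (f 0 + f s) / 2"
    and low: "\<And>n. h (1 / 2 ^ n) \<le> 2 ^ n * (f (1 / 2 ^ n) - f 0)"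
    and lim: "(\<lambda>n. h (1 / 2 ^ n)) \<longlonglongrightarrow> l"
  shows "f 0 + l \<le> f 1"
proof -
  have "2 ^ n * (f (1 / 2 ^ n) - f 0) \<le> f 1 - f 0" for n
  proof (induction n)
    case (Suc n)
    have "2 * (f (1 / 2 ^ Suc n) - f 0) \<le> f (1 / 2 ^ n) - f 0"
      using mid[of "1 / 2 ^ n"] by (simp add: field_simps)
    then have "2 ^ n * (2 * (f (1 / 2 ^ Suc n) - f 0)) \<le> 2 ^ n * (f (1 / 2 ^ n) - f 0)"
      by (rule mult_left_mono) simp
    moreover have "(2::real) ^ Suc n * c = 2 ^ n * (2 * c)" for c
      by simp
    ultimately show ?case
      using Suc by (simp only:)
  qed simp
  then have "h (1 / 2 ^ n) \<le> f 1 - f 0" for n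
    using low order_trans by blast
  then have "l \<le> f 1 - f 0"
    by (intro LIMSEQ_le_const2[OF lim]) blast
  then show ?thesis
    by simp
qed

text \<open>
  Midpoint convexity of \<open>tr exp\<close> comes from Golden-Thompson and Cauchy-Schwarz. No derivative of
  \<open>tr exp\<close> is computed: Golden-Thompson for \<open>B = (B + s C) + (- s C)\<close> bounds the difference quotients
  from below.
\<close>

lemma tr_exp_mult_le:
  assumes "adj B = B" "adj C = C"
  shows "tr (exp B * (1 + C)) \<le> tr (exp (B + C))"
proof -
  define f where "f s = tr (exp (B + s *\<^sub>R C))" for s
  \<comment> \<open>\<open>h\<close> comes from solving \<open>f 0 \<le> tr (exp (B + s *\<^sub>R C)
    * exp (s *\<^sub>R - C))\<close> for the difference quotient of \<open>f\<close>; along the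
    dyadic points it tends to \<open>tr (exp B * C)\<close>.\<close>
  define h where "h s = tr (exp (B + s *\<^sub>R C) * (exp (s *\<^sub>R - C) - 1) /\<^sub>R (- s))" for s :: real
  have "f 0 + tr (exp B * C) \<le> f 1"
  proof (rule midpoint_convex_ge_tangent[where h = h])
    fix s :: real
    let ?P = "exp ((1 / 2) *\<^sub>R (B + s *\<^sub>R C))" and ?Q = "exp ((1 / 2) *\<^sub>R B)"
    have "B + (s / 2) *\<^sub>R C = (1 / 2) *\<^sub>R (B + s *\<^sub>R C) + (1 / 2) *\<^sub>R B"
      by (rule endo_eqI) (simp add: algebra_simps flip: scaleR_add_left)
    then have "f (s / 2) \<le> tr (?P * ?Q)"
      using golden_thompson[of "(1 / 2) *\<^sub>R (B + s *\<^sub>R C)" "(1 / 2) *\<^sub>R B"] assms by (simp add: f_def)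
    also have "\<dots> \<le> (tr (?P * adj ?P) + tr (adj ?Q * ?Q)) / 2"
      using tr_mult_le[of ?P ?Q] by simp
    also have "\<dots> = (f 0 + f s) / 2"
      using assms exp_half_mult[of "B + s *\<^sub>R C"] exp_half_mult[of B] by (simp add: f_def adj_exp add.commute)
    finally show "f (s / 2) \<le> (f 0 + f s) / 2" .
  next
    fix n :: nat
    let ?s = "1 / 2 ^ n :: real"
    have "f 0 = tr (exp ((B + ?s *\<^sub>R C) + ?s *\<^sub>R - C))"
      by (simp add: f_def)
    also have "\<dots> \<le> tr (exp (B + ?s *\<^sub>R C) * exp (?s *\<^sub>R - C))"
      using assms by (intro golden_thompson) simp_all
    also have "\<dots> = f ?s - ?s * h ?s"
      by (simp add: f_def h_def tr_simps algebra_simps)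
    finally show "h ?s \<le> 2 ^ n * (f ?s - f 0)"
      by (simp add: field_simps)
  next
    have "((\<lambda>t::real. exp (t *\<^sub>R - C)) has_vector_derivative exp (0 *\<^sub>R - C) * - C) (at 0)"
      by (rule exp_scaleR_has_vector_derivative_right)
    from has_vector_derivative_dyadic[OF this]
    have "(\<lambda>n. - (2 ^ n *\<^sub>R (exp ((1 / 2 ^ n) *\<^sub>R - C) - 1))) \<longlonglongrightarrow> - (- C)"
      by (intro tendsto_minus) simp
    moreover have "continuous_on UNIV (\<lambda>s::real. exp (B + s *\<^sub>R C))"
      by (intro continuous_on_exp_algebra continuous_intros)
    then have "(\<lambda>n. exp (B + (1 / 2 ^ n :: real) *\<^sub>R C)) \<longlonglongrightarrow> exp (B + 0 *\<^sub>R C)"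
      by (rule continuous_on_tendsto_compose) (auto intro: LIMSEQ_divide_realpow_zero)
    ultimately have "(\<lambda>n. tr (exp (B + (1 / 2 ^ n :: real) *\<^sub>R C) * - (2 ^ n *\<^sub>R (exp ((1 / 2 ^ n) *\<^sub>R - C) - 1)))) \<longlonglongrightarrow> tr (exp (B + 0 *\<^sub>R C) * - (- C))"
      by (intro bounded_linear.tendsto[OF bounded_linear_tr] tendsto_mult)
    then show "(\<lambda>n. h (1 / 2 ^ n)) \<longlonglongrightarrow> tr (exp B * C)"
      by (simp add: h_def tr_simps)
  qed
  then show ?thesis
    by (simp add: f_def tr_simps distrib_left)
qed

text \<open>With \<open>?Q\<close> the self-adjoint square root of \<open>exp H\<close>, cyclicity
  turns the left side into a sum of quadratic forms of \<open>X ^ n\<close> at the vectors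
  \<open>(X * ?Q) $$ b\<close>. Each is at most \<open>r ^ n\<close> times the squared norm of its
  vector, even if \<open>X ^ n\<close> is indefinite.\<close>

lemma tr_power_mult_le:
  assumes "adj H = H" "adj X = X" "norm X \<le> r"
  shows "tr (exp H * X ^ (n + 2)) \<le> r ^ n * tr (exp H * (X * X))"
proof -
  let ?Q = "exp ((1 / 2) *\<^sub>R H)"
  have r: "0 \<le> r"
    using assms(3) norm_ge_zero order_trans by blast
  have eq: "tr (exp H * Z) = tr (adj ?Q * (Z * ?Q))" for Z
    using assms(1) tr_commute[of ?Q "Z * ?Q"] tr_commute[of "exp H" Z] exp_half_mult[of H]
    by (simp add: adj_exp mult.assoc)
  have "X ^ (n + 2) = X * X ^ n * X"
    by (simp add: power_commutes mult.assoc)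
  then have "tr (exp H * X ^ (n + 2)) = tr (adj (X * ?Q) * (X ^ n * (X * ?Q)))"
    by (simp only: eq \<open>X ^ (n + 2) = X * X ^ n * X\<close> adj_simps assms(2) mult.assoc)
  also have "\<dots> = (\<Sum>b\<in>Basis. (X * ?Q) $$ b \<bullet> (X ^ n) $$ ((X * ?Q) $$ b))"
    by (simp only: tr_adj_mult endo_apply_simps)
  also have "\<dots> \<le> (\<Sum>b\<in>Basis. r ^ n * ((X * ?Q) $$ b \<bullet> (X * ?Q) $$ b))"
  proof (rule sum_mono)
    fix b
    let ?u = "(X * ?Q) $$ b"
    have "?u \<bullet> (X ^ n) $$ ?u \<le> norm ?u * norm ((X ^ n) $$ ?u)"
      by (rule norm_cauchy_schwarz)
    also have "\<dots> \<le> norm ?u * (r ^ n * norm ?u)"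
      using assms(3) r
      by (intro mult_left_mono order_trans[OF norm_endo_apply] mult_right_mono
          order_trans[OF norm_power_ineq] power_mono) auto
    finally show "?u \<bullet> (X ^ n) $$ ?u \<le> r ^ n * (?u \<bullet> ?u)"
      by (simp add: mult_ac flip: power2_norm_eq_inner power2_eq_square)
  qed
  also have "\<dots> = r ^ n * tr (adj (X * ?Q) * (X * ?Q))"
    by (simp only: tr_adj_mult sum_distrib_left)
  also have "\<dots> = r ^ n * tr (exp H * (X * X))"
    using assms(2) by (simp add: eq mult.assoc)
  finally show ?thesis .
qed

text \<open>This is the scalar estimate
  \<open>exp x \<le> 1 + x + x\<^sup>2 / (2 * (1 - r / 3))\<close> for
  \<open>\<bar>x\<bar> \<le> r\<close> in traced form. The series is compared term by term from the
  quadratic term on, with the powers controlled by \<open>tr_power_mult_le\<close>.\<close>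

lemma tr_exp_mult_exp_le:
  assumes "adj H = H" "adj X = X" "norm X \<le> r" "r < 3"
  shows "tr (exp H * exp X) \<le> tr (exp H * (1 + X + (1 / (2 * (1 - r / 3))) *\<^sub>R (X * X)))"
proof -
  have r: "0 \<le> r"
    using assms(3) norm_ge_zero order_trans by blast
  let ?c = "tr (exp H * (X * X))"
  \<comment> \<open>The sign of \<open>?c\<close> is needed to enlarge its coefficients termwise. It
    is the trace of \<open>adj Z * Z\<close> for
    \<open>Z = X * exp ((1 / 2) *\<^sub>R H)\<close>.\<close>
  have c: "0 \<le> ?c"
    using tr_power_mult_le[OF assms(1-3), of 0] tr_adj_self_nonneg[of "X * exp ((1 / 2) *\<^sub>R H)"] assms(1,2)
      tr_commute[of "exp ((1 / 2) *\<^sub>R H)" "X * X * exp ((1 / 2) *\<^sub>R H)"] tr_commute[of "exp H" "X * X"]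
    by (simp add: adj_exp mult.assoc exp_half_mult[of H])
  have "(\<lambda>n. exp H * (X ^ n /\<^sub>R fact n)) sums (exp H * exp X)"
    by (intro sums_mult exp_converges)
  then have s: "(\<lambda>n. tr (exp H * (X ^ n /\<^sub>R fact n))) sums tr (exp H * exp X)"
    by (rule bounded_linear.sums[OF bounded_linear_tr])
  have lhs: "(\<lambda>n. tr (exp H * (X ^ (n + 2) /\<^sub>R fact (n + 2)))) sums (tr (exp H * exp X) - tr (exp H * (1 + X)))"
    using sums_split_initial_segment[OF s, of 2] by (simp add: numeral_2_eq_2 tr_simps distrib_left)
  have rhs: "(\<lambda>n. (r / 3) ^ n * (?c / 2)) sums (1 / (1 - r / 3) * (?c / 2))"
    using r assms(4) by (intro sums_mult2 geometric_sums) simp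
  have "tr (exp H * (X ^ (n + 2) /\<^sub>R fact (n + 2))) \<le> (r / 3) ^ n * (?c / 2)" for n
  proof -
    \<comment> \<open>\<open>n! \<ge> 2 \<cdot> 3\<^sup>n\<^sup>-\<^sup>2\<close> turns the exponential series into the geometric one behind \<open>R t / 3\<close>.\<close>
    have "2 * 3 ^ n \<le> (fact (n + 2) :: real)"
    proof (induction n)
      case (Suc n)
      have "2 * 3 ^ Suc n = 3 * (2 * 3 ^ n :: real)"
        by simp
      also have "\<dots> \<le> real (n + 3) * fact (n + 2)"
        using Suc by (intro mult_mono) auto
      finally show ?case
        by (simp add: algebra_simps)
    qed simp
    then have "inverse (fact (n + 2)) \<le> (inverse (2 * 3 ^ n) :: real)"
      by (rule le_imp_inverse_le) simp
    then have "inverse (fact (n + 2)) * tr (exp H * X ^ (n + 2)) \<le> inverse (2 * 3 ^ n) * (r ^ n * ?c)"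
      using c r tr_power_mult_le[OF assms(1-3), of n]
      by (meson mult_left_mono mult_right_mono order_trans inverse_nonnegative_iff_nonnegative fact_ge_zero mult_nonneg_nonneg zero_le_power)
    then show ?thesis
      by (simp add: tr_simps power_divide field_simps del: fact_Suc)
  qed
  then have "tr (exp H * exp X) - tr (exp H * (1 + X)) \<le> 1 / (1 - r / 3) * (?c / 2)"
    by (rule sums_le[OF _ lhs rhs])
  then show ?thesis
    by (simp add: tr_simps distrib_left add.assoc mult.commute[of r])
qed

lemma inner_exp_ge:
  assumes "adj A = A" "norm v = 1"
  shows "exp (v \<bullet> A $$ v) \<le> v \<bullet> exp A $$ v"
proof -
  define a where "a = v \<bullet> A $$ v"
  \<comment> \<open>Centring at the mean \<open>a\<close> removes the first-order term at 0. The
    factor \<open>exp a\<close> is restored at the end, since multiples of the identity commute with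
    \<open>B\<close>.\<close>
  define B where "B = A - a *\<^sub>R 1"
  define f where "f s = v \<bullet> exp (s *\<^sub>R B) $$ v" for s
  have v: "v \<bullet> v = 1"
    using assms(2) by (simp add: norm_eq_1)
  have B: "adj B = B"
    using assms by (simp add: B_def)
  have f0: "f 0 = 1"
    by (simp add: f_def v)
  \<comment> \<open>Jensen's inequality: \<open>f\<close> is midpoint convex and has derivative \<open>0\<close> at \<open>0\<close>.\<close>
  have "f 0 + 0 \<le> f 1"
  proof (rule midpoint_convex_ge_tangent[where h = "\<lambda>s. inverse s * (f s - f 0)"])
    fix s
    let ?u = "exp ((s / 2) *\<^sub>R B) $$ v"
    have cs: "2 * (v \<bullet> ?u) \<le> v \<bullet> v + ?u \<bullet> ?u"
      using inner_ge_zero[of "v - ?u"] by (simp add: inner_simps inner_commute)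
    have "?u \<bullet> ?u = v \<bullet> (adj (exp ((s / 2) *\<^sub>R B)) * exp ((s / 2) *\<^sub>R B)) $$ v"
      by (simp add: inner_adj)
    moreover have "adj (exp ((s / 2) *\<^sub>R B)) * exp ((s / 2) *\<^sub>R B) = exp (s *\<^sub>R B)"
      using exp_half_mult[of "s *\<^sub>R B"] B by (simp add: adj_exp)
    ultimately have "?u \<bullet> ?u = f s"
      by (simp only: f_def)
    with cs f0 v show "f (s / 2) \<le> (f 0 + f s) / 2"
      by (simp add: f_def[of "s / 2"])
  next
    have "((\<lambda>t. exp (t *\<^sub>R B)) has_vector_derivative exp (0 *\<^sub>R B) * B) (at 0)"
      by (rule exp_scaleR_has_vector_derivative_right)
    from has_vector_derivative_dyadic[OF this]
    have "(\<lambda>n. v \<bullet> (2 ^ n *\<^sub>R (exp ((1 / 2 ^ n :: real) *\<^sub>R B) - exp (0 *\<^sub>R B))) $$ v) \<longlonglongrightarrow> v \<bullet> (exp (0 *\<^sub>R B) * B) $$ v"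
      by (intro tendsto_inner tendsto_const bounded_linear.tendsto[OF bounded_linear_endo_eval])
    moreover have "v \<bullet> (exp (0 *\<^sub>R B) * B) $$ v = 0"
      by (simp add: B_def inner_simps v a_def)
    ultimately show "(\<lambda>n. inverse (1 / 2 ^ n) * (f (1 / 2 ^ n) - f 0)) \<longlonglongrightarrow> 0"
      by (simp add: f_def inner_simps)
  qed simp
  moreover have "exp A = exp a *\<^sub>R exp B"
  proof -
    have "exp (a *\<^sub>R 1 :: 'a endo) = exp a *\<^sub>R 1"
      using exp_of_real[of a, where 'a = "'a endo"] by (simp add: of_real_def)
    moreover have "exp A = exp (a *\<^sub>R 1 + B)"
      by (simp add: B_def)
    moreover have "a *\<^sub>R 1 * B = B * a *\<^sub>R 1"
      by simp
    ultimately show ?thesis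
      by (simp add: exp_add_commuting)
  qed
  ultimately show ?thesis
    using f0 by (simp add: f_def a_def)
qed

text \<open>With \<open>?Q\<close> the square root of \<open>exp A\<close>, the form
  \<open>u \<bullet> exp A $$ u\<close> is the sum of the squares of
  \<open>?Q $$ b \<bullet> u\<close>. Bessel's inequality for the orthonormal pair, summed over the
  basis, gives the trace. Two vectors are taken because the real trace counts each complex
  eigenvalue twice.\<close>

lemma tr_exp_ge:
  assumes "adj A = A" "norm v = 1" "norm w = 1" "v \<bullet> w = 0"
  shows "exp (v \<bullet> A $$ v) + exp (w \<bullet> A $$ w) \<le> tr (exp A)"
proof -
  let ?Q = "exp ((1 / 2) *\<^sub>R A)"
  have vw: "v \<bullet> v = 1" "w \<bullet> w = 1" "w \<bullet> v = 0"
    using assms by (simp_all add: norm_eq_1 inner_commute)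
  have Q: "adj ?Q = ?Q"
    using assms(1) by (simp add: adj_exp)
  have eq: "u \<bullet> exp A $$ u = (\<Sum>b\<in>Basis. (?Q $$ b \<bullet> u)\<^sup>2)" for u
  proof -
    have sym: "?Q $$ u \<bullet> b = ?Q $$ b \<bullet> u" for b
      using inner_adj[of u ?Q b] by (simp only: Q inner_commute[of u])
    have "u \<bullet> exp A $$ u = u \<bullet> (adj ?Q * ?Q) $$ u"
      by (simp only: Q exp_half_mult)
    also have "\<dots> = ?Q $$ u \<bullet> ?Q $$ u"
      by (simp add: inner_adj)
    also have "\<dots> = (\<Sum>b\<in>Basis. (?Q $$ u \<bullet> b)\<^sup>2)"
      by (subst euclidean_inner) (simp add: power2_eq_square)
    finally show ?thesis
      by (simp only: sym)
  qed
  have "exp (v \<bullet> A $$ v) + exp (w \<bullet> A $$ w) \<le> v \<bullet> exp A $$ v + w \<bullet> exp A $$ w"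
    using assms by (intro add_mono inner_exp_ge)
  also have "\<dots> = (\<Sum>b\<in>Basis. (?Q $$ b \<bullet> v)\<^sup>2 + (?Q $$ b \<bullet> w)\<^sup>2)"
    by (simp add: eq sum.distrib)
  also have "\<dots> \<le> (\<Sum>b\<in>Basis. ?Q $$ b \<bullet> ?Q $$ b)"
  proof (rule sum_mono)
    fix b
    let ?x = "?Q $$ b"
    have "0 \<le> (?x - (?x \<bullet> v) *\<^sub>R v - (?x \<bullet> w) *\<^sub>R w) \<bullet> (?x - (?x \<bullet> v) *\<^sub>R v - (?x \<bullet> w) *\<^sub>R w)"
      by simp
    also have "\<dots> = ?x \<bullet> ?x - (?x \<bullet> v)\<^sup>2 - (?x \<bullet> w)\<^sup>2"
      using vw assms(4)
      by (simp only: inner_diff_left inner_diff_right inner_scaleR_left inner_scaleR_right inner_commute[of v ?x] inner_commute[of w ?x])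
        (simp add: power2_eq_square algebra_simps)
    finally show "(?x \<bullet> v)\<^sup>2 + (?x \<bullet> w)\<^sup>2 \<le> ?x \<bullet> ?x"
      by simp
  qed
  also have "\<dots> = tr (adj ?Q * ?Q)"
    by (simp only: tr_adj_mult)
  also have "\<dots> = tr (exp A)"
    by (simp only: Q exp_half_mult)
  finally show ?thesis .
qed

lemma tr_exp_nonneg:
  assumes "adj A = A"
  shows "0 \<le> tr (exp A)"
  using tr_adj_self_nonneg[of "exp ((1 / 2) *\<^sub>R A)"] assms by (simp add: adj_exp exp_half_mult)

section \<open>Hermitian dilation\<close>

lemma linear_cmatrix: "linear ((*v) (A :: complex ^ 'c ^ 'r))"
  by (rule bounded_linear.linear[OF bounded_linear_cmatrix])

lemma cadjoint_add: "cadjoint (A + B) = cadjoint A + cadjoint B"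
  by (simp add: cadjoint_def vec_eq_iff)

lemma cadjoint_scaleR: "cadjoint (c *\<^sub>R A) = c *\<^sub>R cadjoint A"
  by (simp add: cadjoint_def vec_eq_iff)

lemma cadjoint_matrix_mult: "cadjoint (A ** B) = cadjoint B ** cadjoint A"
  by (simp add: cadjoint_def vec_eq_iff matrix_matrix_mult_def mult.commute)

lemma matrix_vector_mult_scaleR: "(c *\<^sub>R A) *v x = c *\<^sub>R (A *v x)"
  for A :: "complex ^ 'c ^ 'r"
  by (simp add: vec_eq_iff matrix_vector_mult_def scaleR_sum_right)

text \<open>Self-adjoint even when \<open>A\<close> is rectangular, and its square has the blocks
  \<open>A ** cadjoint A\<close> and \<open>cadjoint A ** A\<close>. Thus one self-adjoint process
  captures the column and the row variation together.\<close>

definition dilation :: "complex ^ 'c ^ 'r \<Rightarrow> ((complex ^ 'r) \<times> (complex ^ 'c)) endo"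
  where "dilation A = to_endo (\<lambda>(x, y). (A *v y, cadjoint A *v x))"

definition block_diag :: "complex ^ 'r ^ 'r \<Rightarrow> complex ^ 'c ^ 'c \<Rightarrow> ((complex ^ 'r) \<times> (complex ^ 'c)) endo"
  where "block_diag P Q = to_endo (\<lambda>(x, y). (P *v x, Q *v y))"

lemma dilation_apply [simp]: "dilation A $$ (x, y) = (A *v y, cadjoint A *v x)"
proof -
  have "linear (\<lambda>(x, y). (A *v y, cadjoint A *v x))"
    by (rule linearI) (auto simp: linear_add[OF linear_cmatrix] linear_scale[OF linear_cmatrix])
  then show ?thesis
    by (simp add: dilation_def)
qed

lemma block_diag_apply [simp]: "block_diag P Q $$ (x, y) = (P *v x, Q *v y)"
proof -
  have "linear (\<lambda>(x, y). (P *v x, Q *v y))"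
    by (rule linearI) (auto simp: linear_add[OF linear_cmatrix] linear_scale[OF linear_cmatrix])
  then show ?thesis
    by (simp add: block_diag_def)
qed

lemma endo_prod_eqI: "(\<And>x y. A $$ (x, y) = B $$ (x, y)) \<Longrightarrow> A = B"
  by (rule endo_eqI) auto

lemma linear_dilation: "linear dilation"
  by (rule linearI; rule endo_prod_eqI)
    (simp_all add: cadjoint_add cadjoint_scaleR matrix_vector_mult_add_rdistrib matrix_vector_mult_scaleR)

lemma linear_block_diag: "linear (\<lambda>(P, Q). block_diag P Q)"
  by (rule linearI; clarsimp; rule endo_prod_eqI)
    (simp_all add: matrix_vector_mult_add_rdistrib matrix_vector_mult_scaleR)

lemma block_diag_add: "block_diag (P + P') (Q + Q') = block_diag P Q + block_diag P' Q'"
  using linear_add[OF linear_block_diag, of "(P, Q)" "(P', Q')"] by simp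

lemma adj_dilation: "adj (dilation A) = dilation A"
proof (rule adj_eqI)
  show "x \<bullet> dilation A $$ y = dilation A $$ x \<bullet> y" for x y
    by (cases x; cases y) (simp add: inner_cadjoint inner_commute[of _ "A *v _"])
qed

lemma adj_block_diag: "adj (block_diag P Q) = block_diag (cadjoint P) (cadjoint Q)"
proof (rule adj_eqI)
  show "x \<bullet> block_diag (cadjoint P) (cadjoint Q) $$ y = block_diag P Q $$ x \<bullet> y" for x y
    by (cases x; cases y) (simp add: inner_cadjoint)
qed

lemma dilation_square: "dilation A * dilation A = block_diag (A ** cadjoint A) (cadjoint A ** A)"
  by (rule endo_prod_eqI) (simp add: matrix_vector_mul_assoc)

section \<open>Spectral norm estimates and test vectors for the dilation\<close>

lemma norm_mult_le_spectral_norm: "norm (A *v x) \<le> spectral_norm A * norm x"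
  unfolding spectral_norm_eq_onorm by (rule onorm[OF bounded_linear_cmatrix])

lemma spectral_norm_nonneg: "0 \<le> spectral_norm A"
  unfolding spectral_norm_eq_onorm by (rule onorm_pos_le[OF bounded_linear_cmatrix])

text \<open>The two image components are orthogonal and each is bounded with the same factor
  \<open>spectral_norm A\<close>, so Pythagoras loses no constant.\<close>

lemma norm_dilation_le: "norm (dilation A) \<le> spectral_norm A" for A :: "complex ^ 'c ^ 'r"
proof (rule norm_endo_bound)
  fix z :: "(complex ^ 'r) \<times> (complex ^ 'c)"
  obtain x y where z: "z = (x, y)"
    by (cases z)
  let ?s = "spectral_norm A"
  have "(norm (dilation A $$ z))\<^sup>2 = (norm (A *v y))\<^sup>2 + (norm (cadjoint A *v x))\<^sup>2"
    by (simp add: z norm_Pair)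
  also have "\<dots> \<le> (?s * norm y)\<^sup>2 + (?s * norm x)\<^sup>2"
    unfolding spectral_norm_eq_onorm
    by (intro add_mono power_mono norm_cadjoint_le onorm[OF bounded_linear_cmatrix]) auto
  also have "\<dots> = (?s * norm z)\<^sup>2"
    by (simp add: z norm_Pair power_mult_distrib distrib_left)
  finally show "norm (dilation A $$ z) \<le> ?s * norm z"
    by (rule power2_le_imp_le) (simp add: spectral_norm_nonneg)
qed (rule spectral_norm_nonneg)

text \<open>A crude entrywise comparison. It serves to turn spectral norm bounds into almost sure
  boundedness, from which integrability follows.\<close>

lemma norm_matrix_le_spectral_norm:
  "norm A \<le> real (CARD('r) * CARD('c)) * spectral_norm A" for A :: "complex ^ 'c ^ 'r"
proof -
  have entry: "norm (A $ i $ j) \<le> spectral_norm A" for i j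
  proof -
    have "A $ i $ j = (A *v axis j 1) $ i"
      by (simp add: matrix_vector_mult_def axis_def if_distrib cong: if_cong)
    also have "norm \<dots> \<le> norm (A *v axis j 1)"
      by (rule Finite_Cartesian_Product.norm_nth_le)
    also have "\<dots> \<le> spectral_norm A"
      using norm_mult_le_spectral_norm[of A "axis j 1"] by (simp add: norm_Basis axis_in_Basis_iff Basis_complex_def)
    finally show ?thesis .
  qed
  have "norm A \<le> (\<Sum>i\<in>UNIV. norm (A $ i))"
    by (simp add: norm_vec_def L2_set_le_sum)
  also have "\<dots> \<le> (\<Sum>i\<in>UNIV. \<Sum>j\<in>UNIV. norm (A $ i $ j))"
    by (intro sum_mono) (simp add: norm_vec_def L2_set_le_sum)
  also have "\<dots> \<le> (\<Sum>i\<in>(UNIV :: 'r set). \<Sum>j\<in>(UNIV :: 'c set). spectral_norm A)"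
    by (intro sum_mono entry)
  finally show ?thesis
    by simp
qed

text \<open>A top pair of singular vectors: \<open>u\<close> is a normalised eigenvector of
  \<open>cadjoint A ** A\<close> and \<open>w\<close> its normalised image. If the norm is 0, the
  image gives no direction and any unit vector serves as \<open>w\<close>.\<close>

lemma spectral_norm_attained:
  fixes A :: "complex ^ 'c ^ 'r"
  obtains u w where "norm u = 1" "norm w = 1" "A *v u = spectral_norm A *\<^sub>R w"
proof -
  let ?s = "spectral_norm A"
  obtain v where v: "v \<noteq> 0" "cadjoint A *v (A *v v) = ?s\<^sup>2 *\<^sub>R v"
    using singular_value_onorm[of A] unfolding singular_value_def spectral_norm_eq_onorm[symmetric]
    by (auto simp only: of_real_vector_smult matrix_vector_mul_assoc)
  have "(A *v v) \<bullet> (A *v v) = ?s\<^sup>2 * (v \<bullet> v)"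
    by (simp add: inner_cadjoint v)
  then have nv: "norm (A *v v) = ?s * norm v"
    by (simp add: norm_eq_sqrt_inner real_sqrt_mult spectral_norm_nonneg)
  define u where "u = v /\<^sub>R norm v"
  have u: "norm u = 1" and Au: "norm (A *v u) = ?s"
    using v(1) by (simp_all add: u_def nv linear_scale[OF linear_cmatrix])
  show ?thesis
  proof (cases "?s = 0")
    case True
    obtain w :: "complex ^ 'r" where "norm w = 1"
      using vector_choose_size zero_le_one by blast
    with that[of u w] u Au True show ?thesis
      by simp
  next
    case False
    show ?thesis
      using u Au False by (intro that[of u "(A *v u) /\<^sub>R ?s"]) (simp_all add: abs_of_nonneg spectral_norm_nonneg)
  qed
qed

lemma inner_le_spectral_norm: "x \<bullet> (A *v x) \<le> spectral_norm A * (norm x)\<^sup>2"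
proof -
  have "x \<bullet> (A *v x) \<le> norm x * (spectral_norm A * norm x)"
    by (intro order_trans[OF norm_cauchy_schwarz] mult_left_mono norm_mult_le_spectral_norm) simp
  then show ?thesis
    by (simp add: power2_eq_square mult_ac)
qed

text \<open>At \<open>z\<close> the quadratic form of the dilation equals the spectral norm of
  \<open>A\<close>. Each diagonal block sees half of the squared norm of \<open>z\<close>, so both
  blocks together contribute at most \<open>m\<close>.\<close>

lemma inner_dilation_block_diag_ge:
  assumes "norm u = 1" "norm w = 1" "A *v u = spectral_norm A *\<^sub>R w"
    and "spectral_norm P \<le> m" "spectral_norm Q \<le> m" "0 \<le> g"
  defines "z \<equiv> (1 / sqrt 2) *\<^sub>R (w, u)"
  shows "norm z = 1" "\<theta> * spectral_norm A - g * m \<le> z \<bullet> (\<theta> *\<^sub>R dilation A - g *\<^sub>R block_diag P Q) $$ z"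
proof -
  show "norm z = 1"
    using assms(1,2) by (simp add: z_def norm_Pair power_divide)
  have sq: "w \<bullet> w = 1" "u \<bullet> u = 1"
    using assms(1,2) by (simp_all add: norm_eq_1)
  have "u \<bullet> (cadjoint A *v w) = (A *v u) \<bullet> w"
    by (simp add: inner_cadjoint)
  then have "(w, u) \<bullet> dilation A $$ (w, u) = 2 * spectral_norm A"
    using assms(3) sq by simp
  then have D: "z \<bullet> dilation A $$ z = spectral_norm A"
    by (simp add: z_def endo_apply_scaleR_right del: dilation_apply scaleR_Pair)
  have "(w, u) \<bullet> block_diag P Q $$ (w, u) \<le> m * 1 + m * 1"
    using inner_le_spectral_norm[of w P] inner_le_spectral_norm[of u Q] assms(1,2,4,5)
    by simp
  then have B: "z \<bullet> block_diag P Q $$ z \<le> m"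
    by (simp add: z_def endo_apply_scaleR_right del: block_diag_apply scaleR_Pair)
  show "\<theta> * spectral_norm A - g * m \<le> z \<bullet> (\<theta> *\<^sub>R dilation A - g *\<^sub>R block_diag P Q) $$ z"
    using mult_left_mono[OF B assms(6)] by (simp add: inner_diff_right D)
qed

lemma matrix_vector_mult_smult: "A *v (c *s x) = c *s (A *v x)" for A :: "complex ^ 'c ^ 'r"
  by (simp add: vec_eq_iff matrix_vector_mult_def sum_distrib_left mult.left_commute)

lemma norm_smult_ii: "norm (\<i> *s x) = norm x" for x :: "complex ^ 'n"
  by (simp add: norm_vec_def norm_mult)

lemma inner_smult_ii: "x \<bullet> (\<i> *s x) = 0" for x :: "complex ^ 'n"
  by (simp add: inner_vec_def inner_complex_def mult.commute)

text \<open>Multiplying a singular pair by \<open>\<i>\<close> gives another one, orthogonal to the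
  first in the real inner product. These two test vectors produce the factor 2 that offsets the
  doubled dimension.\<close>

lemma tr_exp_dilation_ge:
  fixes A :: "complex ^ 'c ^ 'r"
  assumes "cadjoint P = P" "cadjoint Q = Q" "spectral_norm P \<le> m" "spectral_norm Q \<le> m"
    and "0 \<le> g" "0 \<le> \<theta>" "t \<le> spectral_norm A"
  shows "2 * exp (\<theta> * t - g * m) \<le> tr (exp (\<theta> *\<^sub>R dilation A - g *\<^sub>R block_diag P Q))"
proof -
  obtain u w where uw: "norm u = 1" "norm w = 1" "A *v u = spectral_norm A *\<^sub>R w"
    by (rule spectral_norm_attained)
  have iuw: "norm (\<i> *s u) = 1" "norm (\<i> *s w) = 1" "A *v (\<i> *s u) = spectral_norm A *\<^sub>R (\<i> *s w)"
    by (simp_all add: uw norm_smult_ii matrix_vector_mult_smult) (simp add: vec_eq_iff)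
  let ?T = "\<theta> *\<^sub>R dilation A - g *\<^sub>R block_diag P Q"
  let ?z = "(1 / sqrt 2) *\<^sub>R (w, u)" and ?z' = "(1 / sqrt 2) *\<^sub>R (\<i> *s w, \<i> *s u)"
  note z = inner_dilation_block_diag_ge[OF uw assms(3-5)]
  note z' = inner_dilation_block_diag_ge[OF iuw assms(3-5)]
  have "\<theta> * t \<le> \<theta> * spectral_norm A"
    by (intro mult_left_mono assms)
  then have "2 * exp (\<theta> * t - g * m) \<le> exp (?z \<bullet> ?T $$ ?z) + exp (?z' \<bullet> ?T $$ ?z')"
    using add_mono[of "exp (\<theta> * t - g * m)" "exp (?z \<bullet> ?T $$ ?z)" "exp (\<theta> * t - g * m)" "exp (?z' \<bullet> ?T $$ ?z')"]
      z(2)[of \<theta>] z'(2)[of \<theta>] by simp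
  also have "\<dots> \<le> tr (exp ?T)"
  proof (rule tr_exp_ge)
    show "adj ?T = ?T"
      using assms(1,2) by (simp add: adj_dilation adj_block_diag)
    show "?z \<bullet> ?z' = 0"
      by (simp add: inner_smult_ii)
  qed (use z(1) z'(1) in auto)
  finally show ?thesis .
qed

section \<open>Conditional expectations and the maximal inequality\<close>

text \<open>The real basis of the matrix space picks out real and imaginary parts of entries, so
  scalar facts about \<open>real_cond_exp\<close> transfer coordinate by coordinate.\<close>

lemma matrix_cond_exp_inner_Basis:
  fixes Z :: "'a \<Rightarrow> complex ^ 'c ^ 'r"
  assumes "b \<in> Basis"
  shows "matrix_cond_exp M G Z \<omega> \<bullet> b = real_cond_exp M G (\<lambda>\<omega>. Z \<omega> \<bullet> b) \<omega>"
proof -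
  obtain i j e where "b = axis i (axis j e)" "e = 1 \<or> e = \<i>"
    using assms by (auto simp: Basis_vec_def Basis_complex_def)
  then show ?thesis
    by (auto simp: inner_axis matrix_cond_exp_def inner_complex_def)
qed

lemma borel_measurable_matrix_cond_exp: "matrix_cond_exp M G Z \<in> borel_measurable G"
  by (subst borel_measurable_euclidean_space) (simp add: matrix_cond_exp_inner_Basis)

lemma AE_norm_mult_le:
  fixes X :: "'a \<Rightarrow> 'b::real_normed_algebra"
  assumes "AE \<omega> in M. norm (X \<omega>) \<le> K" "AE \<omega> in M. norm (Y \<omega>) \<le> L" "0 \<le> K"
  shows "AE \<omega> in M. norm (X \<omega> * Y \<omega>) \<le> K * L"
  using assms(1,2)
proof eventually_elim
  case (elim \<omega>)
  then show ?case
    using assms(3) by (intro order_trans[OF norm_mult_ineq] mult_mono) auto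
qed

section \<open>Bounds, symmetry and take-out for the matrix conditional expectation\<close>

context
  fixes M G :: "'a measure"
  assumes prob: "prob_space M" and sub: "subalgebra M G"
begin

interpretation prob_space M
  by (rule prob)

interpretation finite_measure_subalgebra M G
  by unfold_locales (rule sub)

lemma AE_norm_matrix_cond_exp_le:
  fixes Z :: "'a \<Rightarrow> complex ^ 'c ^ 'r" and C :: real
  assumes [measurable]: "Z \<in> borel_measurable M" and "AE \<omega> in M. norm (Z \<omega>) \<le> C"
  shows "AE \<omega> in M. norm (matrix_cond_exp M G Z \<omega>) \<le> DIM(complex ^ 'c ^ 'r) * C"
proof -
  have "AE \<omega> in M. \<bar>matrix_cond_exp M G Z \<omega> \<bullet> b\<bar> \<le> C" if b: "b \<in> Basis" for b
  proof -
    have "AE \<omega> in M. \<bar>Z \<omega> \<bullet> b\<bar> \<le> C"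
      using assms(2) by eventually_elim (rule order_trans[OF Basis_le_norm[OF b]])
    moreover from this have "integrable M (\<lambda>\<omega>. Z \<omega> \<bullet> b)"
      by (intro integrable_const_bound[where B = C]) auto
    moreover have "AE \<omega> in M. Z \<omega> \<bullet> b \<le> C" "AE \<omega> in M. - C \<le> Z \<omega> \<bullet> b"
      using \<open>AE \<omega> in M. \<bar>Z \<omega> \<bullet> b\<bar> \<le> C\<close> by (eventually_elim, simp)+
    ultimately have "AE \<omega> in M. real_cond_exp M G (\<lambda>\<omega>. Z \<omega> \<bullet> b) \<omega> \<le> C"
      and "AE \<omega> in M. - C \<le> real_cond_exp M G (\<lambda>\<omega>. Z \<omega> \<bullet> b) \<omega>"
      using real_cond_exp_le_c real_cond_exp_ge_c by blast+
    then show ?thesis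
      unfolding matrix_cond_exp_inner_Basis[OF b] by eventually_elim auto
  qed
  then have "AE \<omega> in M. \<forall>b\<in>Basis. \<bar>matrix_cond_exp M G Z \<omega> \<bullet> b\<bar> \<le> C"
    by (intro AE_finite_allI finite_Basis) auto
  then show ?thesis
  proof eventually_elim
    case (elim \<omega>)
    have "norm (matrix_cond_exp M G Z \<omega>) \<le> (\<Sum>b\<in>Basis. \<bar>matrix_cond_exp M G Z \<omega> \<bullet> b\<bar>)"
      by (rule norm_le_l1)
    also have "\<dots> \<le> (\<Sum>b\<in>(Basis :: (complex ^ 'c ^ 'r) set). C)"
      by (intro sum_mono) (use elim in auto)
    finally show ?case
      by simp
  qed
qed

text \<open>Mirrored entries have the same real part as functions, hence the same selected version.
  Their imaginary parts are opposite, and linearity of the conditional expectation handles these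
  almost surely.\<close>

lemma AE_cadjoint_matrix_cond_exp:
  fixes Z :: "'a \<Rightarrow> complex ^ 'n ^ 'n" and C :: real
  assumes [measurable]: "Z \<in> borel_measurable M" and "AE \<omega> in M. norm (Z \<omega>) \<le> C"
    and herm: "\<And>\<omega>. cadjoint (Z \<omega>) = Z \<omega>"
  shows "AE \<omega> in M. cadjoint (matrix_cond_exp M G Z \<omega>) = matrix_cond_exp M G Z \<omega>"
proof -
  have sym: "Z \<omega> $ j $ i = cnj (Z \<omega> $ i $ j)" for \<omega> i j
    using arg_cong[OF herm[of \<omega>], of "\<lambda>A. A $ j $ i"] by (simp add: cadjoint_def)
  have "AE \<omega> in M. real_cond_exp M G (\<lambda>\<omega>. Im (Z \<omega> $ j $ i)) \<omega> = - real_cond_exp M G (\<lambda>\<omega>. Im (Z \<omega> $ i $ j)) \<omega>" for i j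
  proof -
    have b: "axis i (axis j \<i>) \<in> (Basis :: (complex ^ 'n ^ 'n) set)"
      by (auto simp: Basis_vec_def Basis_complex_def)
    have Im: "Im (Z \<omega> $ i $ j) = Z \<omega> \<bullet> axis i (axis j \<i>)" for \<omega>
      by (simp add: inner_axis inner_complex_def)
    have "AE \<omega> in M. norm (Im (Z \<omega> $ i $ j)) \<le> C"
      unfolding Im real_norm_def
      using assms(2) by eventually_elim (rule order_trans[OF Basis_le_norm[OF b]])
    then have "integrable M (\<lambda>\<omega>. Im (Z \<omega> $ i $ j))"
      by (rule integrable_const_bound) (simp add: Im)
    from real_cond_exp_cmult[OF this, of "-1"] show ?thesis
      by (subst sym) simp
  qed
  then have "AE \<omega> in M. \<forall>i j. real_cond_exp M G (\<lambda>\<omega>. Im (Z \<omega> $ j $ i)) \<omega> = - real_cond_exp M G (\<lambda>\<omega>. Im (Z \<omega> $ i $ j)) \<omega>"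
    by (simp add: AE_all_countable)
  then show ?thesis
  proof eventually_elim
    case (elim \<omega>)
    have Re: "Re (Z \<omega> $ j $ i) = Re (Z \<omega> $ i $ j)" for \<omega> i j
      by (subst sym) simp
    have "cadjoint (matrix_cond_exp M G Z \<omega>) $ i $ j = matrix_cond_exp M G Z \<omega> $ i $ j" for i j
      using elim[rule_format, of j i] Re[of _ j i] by (simp add: cadjoint_def matrix_cond_exp_def complex_eq_iff)
    then show ?case
      by (simp add: vec_eq_iff)
  qed
qed

text \<open>The take-out property in integrated form. Expanding the argument of \<open>L\<close> in
  the real basis writes the trace as a finite sum of products of a bounded
  \<open>G\<close>-measurable factor \<open>f b\<close> with a coordinate of \<open>Z\<close>, and
  the scalar property applies to each product.\<close>

lemma
  fixes Z :: "'a \<Rightarrow> complex ^ 'c ^ 'r" and H :: "'a \<Rightarrow> 'b::euclidean_space endo" and C K :: real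
  assumes [measurable]: "Z \<in> borel_measurable M" and Z: "AE \<omega> in M. norm (Z \<omega>) \<le> C"
    and [measurable]: "H \<in> borel_measurable G" and H: "AE \<omega> in M. norm (H \<omega>) \<le> K"
    and "linear L" and [measurable]: "A \<in> sets G"
  shows integrable_tr_exp_mult: "integrable M (\<lambda>\<omega>. indicator A \<omega> * tr (exp (H \<omega>) * L (Z \<omega>)))" (is ?thesis1)
    and integrable_tr_exp_mult_cond_exp:
      "integrable M (\<lambda>\<omega>. indicator A \<omega> * tr (exp (H \<omega>) * L (matrix_cond_exp M G Z \<omega>)))" (is ?thesis2)
    and integral_tr_exp_mult_cond_exp:
      "(\<integral>\<omega>. indicator A \<omega> * tr (exp (H \<omega>) * L (matrix_cond_exp M G Z \<omega>)) \<partial>M) =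
       (\<integral>\<omega>. indicator A \<omega> * tr (exp (H \<omega>) * L (Z \<omega>)) \<partial>M)" (is ?thesis3)
proof -
  define f where "f b \<omega> = indicator A \<omega> * tr (exp (H \<omega>) * L b)" for b \<omega>
  have [measurable]: "f b \<in> borel_measurable G" for b
  proof -
    have "continuous_on UNIV (\<lambda>h. tr (exp h * L b))"
      by (intro bounded_linear.continuous_on[OF bounded_linear_tr] continuous_on_mult_right
          continuous_on_exp_algebra continuous_on_id)
    then have [measurable]: "(\<lambda>h. tr (exp h * L b)) \<in> borel_measurable borel"
      by (rule borel_measurable_continuous_onI)
    show ?thesis
      unfolding f_def by measurable
  qed
  obtain T where T: "\<And>A :: 'b endo. norm (tr A) \<le> norm A * T" "0 < T"
    using bounded_linear.pos_bounded[OF bounded_linear_tr] by blast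
  have f_bound: "AE \<omega> in M. norm (f b \<omega>) \<le> exp K * norm (L b) * T" for b
    using H
  proof eventually_elim
    case (elim \<omega>)
    have "norm (f b \<omega>) \<le> norm (tr (exp (H \<omega>) * L b))"
      by (simp add: f_def abs_mult indicator_def)
    also have "\<dots> \<le> norm (exp (H \<omega>) * L b) * T"
      by (rule T)
    also have "\<dots> \<le> exp K * norm (L b) * T"
      using T(2) elim by (intro mult_right_mono order_trans[OF norm_mult_ineq] order_trans[OF norm_exp]) auto
    finally show ?case .
  qed
  have int: "integrable M (\<lambda>\<omega>. f b \<omega> * (Z \<omega> \<bullet> b))" if b: "b \<in> Basis" for b
  proof (rule integrable_const_bound)
    have "AE \<omega> in M. norm (Z \<omega> \<bullet> b) \<le> C"
      unfolding real_norm_def using Z by eventually_elim (rule order_trans[OF Basis_le_norm[OF b]])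
    then show "AE \<omega> in M. norm (f b \<omega> * (Z \<omega> \<bullet> b)) \<le> (exp K * norm (L b) * T) * C"
      using T(2) by (intro AE_norm_mult_le f_bound) auto
    have [measurable]: "f b \<in> borel_measurable M"
      by (rule measurable_from_subalg[OF sub]) measurable
    show "(\<lambda>\<omega>. f b \<omega> * (Z \<omega> \<bullet> b)) \<in> borel_measurable M"
      by measurable
  qed
  have expand: "indicator A \<omega> * tr (exp (H \<omega>) * L z) = (\<Sum>b\<in>Basis. f b \<omega> * (z \<bullet> b))" for \<omega> z
  proof -
    have "tr (exp (H \<omega>) * L z) = tr (exp (H \<omega>) * L (\<Sum>b\<in>Basis. (z \<bullet> b) *\<^sub>R b))"
      by (simp add: euclidean_representation)
    also have "\<dots> = (\<Sum>b\<in>Basis. (z \<bullet> b) * tr (exp (H \<omega>) * L b))"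
      by (simp add: linear_sum[OF assms(5)] linear_scale[OF assms(5)] sum_distrib_left
          linear_sum[OF bounded_linear.linear[OF bounded_linear_tr]] tr_simps)
    finally show ?thesis
      by (simp add: f_def sum_distrib_left mult_ac)
  qed
  show ?thesis1
    unfolding expand by (intro Bochner_Integration.integrable_sum int)
  note cond = real_cond_exp_intg[OF int]
  show ?thesis2
    unfolding expand by (intro Bochner_Integration.integrable_sum)
      (simp add: matrix_cond_exp_inner_Basis cond)
  show ?thesis3
    unfolding expand
    by (subst (1 2) Bochner_Integration.integral_sum) (simp_all add: matrix_cond_exp_inner_Basis cond int)
qed

end

text \<open>A maximal inequality for nonnegative supermartingales, by stopping at the first entrance
  into some \<open>E k\<close>. The supermartingale property is stated through integrals over events
  of \<open>F k\<close>, so no conditional expectation of \<open>S\<close> appears.\<close>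

lemma stopped_maximal_inequality:
  fixes S :: "nat \<Rightarrow> 'a \<Rightarrow> real"
  assumes "prob_space M" and filt: "filtration (space M) F" and sub: "\<And>k. subalgebra M (F k)"
    and int: "\<And>k. integrable M (S k)" and nonneg: "\<And>k. AE \<omega> in M. 0 \<le> S k \<omega>"
    and super: "\<And>k A. A \<in> sets (F k) \<Longrightarrow>
      (\<integral>\<omega>. indicator A \<omega> * S (Suc k) \<omega> \<partial>M) \<le> (\<integral>\<omega>. indicator A \<omega> * S k \<omega> \<partial>M)"
    and E: "\<And>k. E k \<in> sets (F k)" and ge: "\<And>k. AE \<omega> in M. \<omega> \<in> E k \<longrightarrow> c \<le> S k \<omega>"
  shows "c * measure M (\<Union>k. E k) \<le> (\<integral>\<omega>. S 0 \<omega> \<partial>M)"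
proof -
  interpret prob_space M
    by fact
  have EM [measurable]: "E k \<in> sets M" for k
    using E sub unfolding subalgebra_def by blast
  have intA: "integrable M (\<lambda>\<omega>. indicator A \<omega> * S k \<omega>)" if "A \<in> sets M" for A k
    using integrable_mult_indicator[OF that int] by simp
  have split: "c * measure M (A \<inter> E k) + (\<integral>\<omega>. indicator (A - E k) \<omega> * S k \<omega> \<partial>M) \<le> (\<integral>\<omega>. indicator A \<omega> * S k \<omega> \<partial>M)"
    if [measurable]: "A \<in> sets M" for A k
  proof -
    have "c * measure M (A \<inter> E k) = (\<integral>\<omega>. c * indicator (A \<inter> E k) \<omega> \<partial>M)"
      by simp
    also have "\<dots> \<le> (\<integral>\<omega>. indicator (A \<inter> E k) \<omega> * S k \<omega> \<partial>M)"
    proof (rule integral_mono_AE)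
      show "AE \<omega> in M. c * indicator (A \<inter> E k) \<omega> \<le> indicator (A \<inter> E k) \<omega> * S k \<omega>"
        using ge[of k] by eventually_elim (simp add: indicator_def)
      show "integrable M (\<lambda>\<omega>. c * indicator (A \<inter> E k) \<omega>)"
        by (intro integrable_mult_right integrable_real_indicator) (auto simp: emeasure_eq_measure)
    qed (auto intro!: intA)
    finally have le: "c * measure M (A \<inter> E k) \<le> (\<integral>\<omega>. indicator (A \<inter> E k) \<omega> * S k \<omega> \<partial>M)" .
    have "(\<integral>\<omega>. indicator A \<omega> * S k \<omega> \<partial>M) =
        (\<integral>\<omega>. indicator (A \<inter> E k) \<omega> * S k \<omega> + indicator (A - E k) \<omega> * S k \<omega> \<partial>M)"
      by (intro Bochner_Integration.integral_cong) (auto simp: indicator_def)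
    also have "\<dots> = (\<integral>\<omega>. indicator (A \<inter> E k) \<omega> * S k \<omega> \<partial>M) + (\<integral>\<omega>. indicator (A - E k) \<omega> * S k \<omega> \<partial>M)"
      by (intro Bochner_Integration.integral_add intA) auto
    finally show ?thesis
      using le by simp
  qed
  define D where "D n = (\<Union>k\<le>n. E k)" for n
  have DF: "D n \<in> sets (F n)" for n
    unfolding D_def using filtration.sets_F_mono[OF filt] E by (intro sets.finite_UN) auto
  have DM [measurable]: "D n \<in> sets M" for n
    by (simp add: D_def)
  \<comment> \<open>Invariant: outcomes that have entered by time \<open>n\<close> are charged
    \<open>c\<close>, the others still carry \<open>S n\<close>. The step applies
    \<open>super\<close> to the complement of \<open>D n\<close> and then \<open>split\<close> at
    time \<open>Suc n\<close>.\<close>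
  have "c * measure M (D n) + (\<integral>\<omega>. indicator (space M - D n) \<omega> * S n \<omega> \<partial>M) \<le> (\<integral>\<omega>. S 0 \<omega> \<partial>M)" for n
  proof (induction n)
    case 0
    have "(\<integral>\<omega>. indicator (space M) \<omega> * S 0 \<omega> \<partial>M) = (\<integral>\<omega>. S 0 \<omega> \<partial>M)"
      by (intro Bochner_Integration.integral_cong) auto
    moreover have "space M \<inter> E 0 = E 0"
      using sets.sets_into_space[OF EM] by blast
    ultimately show ?case
      using split[of "space M" 0] by (simp add: D_def)
  next
    case (Suc n)
    let ?A = "space M - D n"
    have "D (Suc n) = D n \<union> (?A \<inter> E (Suc n))"
      using sets.sets_into_space[OF EM] by (auto simp: D_def atMost_Suc)
    then have "measure M (D (Suc n)) = measure M (D n) + measure M (?A \<inter> E (Suc n))"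
      by (subst finite_measure_Union[symmetric]) auto
    moreover have "?A - E (Suc n) = space M - D (Suc n)"
      by (auto simp: D_def atMost_Suc)
    moreover have "?A \<in> sets (F n)"
      using sets.compl_sets[OF DF[of n]] sub[of n] unfolding subalgebra_def by metis
    ultimately show ?case
      using Suc split[of ?A "Suc n"] super[of ?A n] by (simp add: distrib_left)
  qed
  moreover have "0 \<le> (\<integral>\<omega>. indicator (space M - D n) \<omega> * S n \<omega> \<partial>M)" for n
    using nonneg[of n] by (intro integral_nonneg_AE) (auto elim!: eventually_mono)
  ultimately have le: "c * measure M (D n) \<le> (\<integral>\<omega>. S 0 \<omega> \<partial>M)" for n
    by (meson add_increasing2 order_trans order_refl)
  have "(\<lambda>n. c * measure M (D n)) \<longlonglongrightarrow> c * measure M (\<Union>n. D n)"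
    by (intro tendsto_mult tendsto_const finite_Lim_measure_incseq)
      (auto simp: incseq_def D_def intro: order_trans)
  moreover have "(\<Union>n. D n) = (\<Union>k. E k)"
    by (auto simp: D_def)
  ultimately show ?thesis
    using le by (metis LIMSEQ_le_const2)
qed

section \<open>The trace supermartingale\<close>

lemma borel_measurable_spectral_norm [measurable]: "spectral_norm \<in> borel_measurable borel"
proof (rule borel_measurable_continuous_onI)
  have "linear (\<lambda>A :: complex ^ 'a ^ 'b. Blinfun ((*v) A))"
    by (rule linearI; rule blinfun_eqI)
      (simp_all add: bounded_linear_Blinfun_apply bounded_linear_cmatrix blinfun.bilinear_simps
        matrix_vector_mult_add_rdistrib matrix_vector_mult_scaleR)
  then have "continuous_on UNIV (\<lambda>A :: complex ^ 'a ^ 'b. norm (Blinfun ((*v) A)))"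
    by (intro continuous_on_norm linear_continuous_on) (simp add: linear_conv_bounded_linear)
  then show "continuous_on UNIV (spectral_norm :: complex ^ 'a ^ 'b \<Rightarrow> real)"
    by (simp add: norm_blinfun.rep_eq bounded_linear_Blinfun_apply bounded_linear_cmatrix
        flip: spectral_norm_eq_onorm)
qed

lemma continuous_on_cmatrix_mult:
  fixes f :: "'a::topological_space \<Rightarrow> complex ^ 'm ^ 'l" and g :: "'a \<Rightarrow> complex ^ 'n ^ 'm"
  assumes "continuous_on S f" "continuous_on S g"
  shows "continuous_on S (\<lambda>x. f x ** g x)"
  unfolding matrix_matrix_mult_def by (intro continuous_intros assms)

lemma continuous_on_cadjoint:
  fixes f :: "'a::topological_space \<Rightarrow> complex ^ 'm ^ 'l"
  assumes "continuous_on S f"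
  shows "continuous_on S (\<lambda>x. cadjoint (f x))"
  unfolding cadjoint_def by (intro continuous_intros continuous_on_cnj assms)

lemma borel_measurable_mult_cadjoint [measurable]:
  "(\<lambda>A. A ** cadjoint A) \<in> borel_measurable borel" "(\<lambda>A. cadjoint A ** A) \<in> borel_measurable borel"
  by (intro borel_measurable_continuous_onI continuous_on_cmatrix_mult continuous_on_cadjoint continuous_on_id)+

lemma spectral_norm_cadjoint_le: "spectral_norm (cadjoint A) \<le> spectral_norm A"
  unfolding spectral_norm_eq_onorm
  by (rule onorm_bound) (auto intro: norm_cadjoint_le onorm_pos_le bounded_linear_cmatrix)

lemma spectral_norm_mult_le: "spectral_norm (A ** B) \<le> spectral_norm A * spectral_norm B"
proof -
  have "norm ((A ** B) *v x) \<le> (spectral_norm A * spectral_norm B) * norm x" for x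
  proof -
    have "norm (A *v (B *v x)) \<le> spectral_norm A * (spectral_norm B * norm x)"
      by (intro order_trans[OF norm_mult_le_spectral_norm] mult_left_mono norm_mult_le_spectral_norm
          spectral_norm_nonneg)
    then show ?thesis
      by (simp add: matrix_vector_mul_assoc mult.assoc)
  qed
  then show ?thesis
    unfolding spectral_norm_eq_onorm[of "A ** B"]
    by (intro onorm_bound) (auto simp: spectral_norm_nonneg)
qed

lemma norm_mult_cadjoint_le:
  fixes A :: "complex ^ 'c ^ 'r"
  assumes "spectral_norm A \<le> R"
  shows "norm (A ** cadjoint A) \<le> real (CARD('r) * CARD('r)) * (R * R)"
    and "norm (cadjoint A ** A) \<le> real (CARD('c) * CARD('c)) * (R * R)"
proof -
  have *: "spectral_norm (cadjoint A) \<le> R" "0 \<le> R"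
    using assms spectral_norm_cadjoint_le[of A] spectral_norm_nonneg[of A] by auto
  then have "spectral_norm (A ** cadjoint A) \<le> R * R" "spectral_norm (cadjoint A ** A) \<le> R * R"
    using assms by (auto intro!: order_trans[OF spectral_norm_mult_le] mult_mono spectral_norm_nonneg)
  then show "norm (A ** cadjoint A) \<le> real (CARD('r) * CARD('r)) * (R * R)"
    and "norm (cadjoint A ** A) \<le> real (CARD('c) * CARD('c)) * (R * R)"
    by (auto intro!: order_trans[OF norm_matrix_le_spectral_norm] mult_left_mono)
qed

text \<open>Defined on triples so that it is one linear map of all three processes; its boundedness
  then yields measurability, norm bounds and the value at time 0.\<close>

definition compensated ::
  "real \<Rightarrow> real \<Rightarrow> (complex ^ 'c ^ 'r) \<times> (complex ^ 'r ^ 'r) \<times> (complex ^ 'c ^ 'c)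
    \<Rightarrow> ((complex ^ 'r) \<times> (complex ^ 'c)) endo"
  where "compensated \<theta> g = (\<lambda>(Y, P, Q). \<theta> *\<^sub>R dilation Y - g *\<^sub>R block_diag P Q)"

lemma bounded_linear_compensated: "bounded_linear (compensated \<theta> g)"
proof -
  have "linear (compensated \<theta> g)"
    by (rule linearI)
      (auto simp: compensated_def linear_add[OF linear_dilation] linear_scale[OF linear_dilation]
        block_diag_add linear_scale[OF linear_block_diag, of _ "(_, _)", simplified] algebra_simps)
  then show ?thesis
    by (simp add: linear_conv_bounded_linear)
qed

lemma borel_measurable_compensated [measurable]: "compensated \<theta> g \<in> borel_measurable borel"
  by (intro borel_measurable_continuous_onI linear_continuous_on bounded_linear_compensated)

lemma AE_norm_compensated_le:
  fixes Y :: "'a \<Rightarrow> complex ^ 'c ^ 'r"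
  assumes "AE \<omega> in M. norm (Y \<omega>) \<le> a" "AE \<omega> in M. norm (P \<omega>) \<le> b" "AE \<omega> in M. norm (Q \<omega>) \<le> c"
  shows "\<exists>K. AE \<omega> in M. norm (compensated \<theta> g (Y \<omega>, P \<omega>, Q \<omega>)) \<le> K"
proof -
  obtain B where B: "\<And>z :: (complex ^ 'c ^ 'r) \<times> (complex ^ 'r ^ 'r) \<times> (complex ^ 'c ^ 'c).
      norm (compensated \<theta> g z) \<le> norm z * B" "0 < B"
    using bounded_linear.pos_bounded[OF bounded_linear_compensated] by blast
  have "AE \<omega> in M. norm (compensated \<theta> g (Y \<omega>, P \<omega>, Q \<omega>)) \<le> (a + (b + c)) * B"
    using assms
  proof eventually_elim
    case (elim \<omega>)
    have "norm (Y \<omega>, P \<omega>, Q \<omega>) \<le> norm (Y \<omega>) + (norm (P \<omega>) + norm (Q \<omega>))"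
      by (intro order_trans[OF norm_Pair_le] add_left_mono norm_Pair_le)
    with elim have "norm (Y \<omega>, P \<omega>, Q \<omega>) \<le> a + (b + c)"
      by linarith
    then show ?case
      using B(2) by (intro order_trans[OF B(1)] mult_right_mono) auto
  qed
  then show ?thesis ..
qed

lemma borel_measurable_tr_exp [measurable]: "(\<lambda>H. tr (exp H)) \<in> borel_measurable borel"
  by (intro borel_measurable_continuous_onI bounded_linear.continuous_on[OF bounded_linear_tr]
      continuous_on_exp_algebra continuous_on_id)

lemma (in prob_space) integrable_tr_exp:
  fixes H :: "'a \<Rightarrow> 'b::euclidean_space endo" and K :: real
  assumes [measurable]: "H \<in> borel_measurable M" and "AE \<omega> in M. norm (H \<omega>) \<le> K"
  shows "integrable M (\<lambda>\<omega>. tr (exp (H \<omega>)))"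
proof -
  obtain T where T: "\<And>A :: 'b endo. norm (tr A) \<le> norm A * T" "0 < T"
    using bounded_linear.pos_bounded[OF bounded_linear_tr] by blast
  have "AE \<omega> in M. norm (tr (exp (H \<omega>))) \<le> exp K * T"
    using assms(2)
  proof eventually_elim
    case (elim \<omega>)
    then have "norm (exp (H \<omega>)) \<le> exp K"
      by (intro order_trans[OF norm_exp]) simp
    then show ?case
      using T(2) by (intro order_trans[OF T(1)] mult_right_mono) auto
  qed
  then show ?thesis
    by (rule integrable_const_bound) measurable
qed

text \<open>One supermartingale step: \<open>Y\<close>, \<open>P\<close>, \<open>Q\<close> form the
  state before it and \<open>X\<close> is the increment. The condition on
  \<open>\<theta> * R\<close> keeps the geometric series convergent, and \<open>g\<close> is the
  coefficient left by the quadratic remainder.\<close>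

lemma integral_tr_exp_compensated_le:
  fixes X Y :: "'a \<Rightarrow> complex ^ 'c ^ 'r" and R a b c \<theta> g :: real
  assumes prob: "prob_space M" and sub: "subalgebra M G"
    and [measurable]: "X \<in> borel_measurable M" "Y \<in> borel_measurable G"
      "P \<in> borel_measurable G" "Q \<in> borel_measurable G" "A \<in> sets G"
    and X: "AE \<omega> in M. spectral_norm (X \<omega>) \<le> R" "AE \<omega> in M. matrix_cond_exp M G X \<omega> = 0"
    and Y: "AE \<omega> in M. norm (Y \<omega>) \<le> a"
    and P: "AE \<omega> in M. norm (P \<omega>) \<le> b" "AE \<omega> in M. cadjoint (P \<omega>) = P \<omega>"
    and Q: "AE \<omega> in M. norm (Q \<omega>) \<le> c" "AE \<omega> in M. cadjoint (Q \<omega>) = Q \<omega>"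
    and \<theta>: "0 \<le> \<theta>" "\<theta> * R < 3" and g: "g = \<theta>\<^sup>2 / (2 * (1 - \<theta> * R / 3))"
  defines "V \<equiv> matrix_cond_exp M G (\<lambda>\<omega>. X \<omega> ** cadjoint (X \<omega>))"
    and "V' \<equiv> matrix_cond_exp M G (\<lambda>\<omega>. cadjoint (X \<omega>) ** X \<omega>)"
  shows "(\<integral>\<omega>. indicator A \<omega> * tr (exp (compensated \<theta> g (Y \<omega> + X \<omega>, P \<omega> + V \<omega>, Q \<omega> + V' \<omega>))) \<partial>M)
    \<le> (\<integral>\<omega>. indicator A \<omega> * tr (exp (compensated \<theta> g (Y \<omega>, P \<omega>, Q \<omega>))) \<partial>M)"
proof -
  interpret prob_space M
    by (rule prob)
  have from_G [measurable (raw)]: "f \<in> borel_measurable M" if "f \<in> borel_measurable G"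
    for f :: "'a \<Rightarrow> 'e::topological_space"
    using measurable_from_subalg[OF sub that] .
  have AM [measurable]: "A \<in> sets M"
    using sub \<open>A \<in> sets G\<close> unfolding subalgebra_def by blast
  have XX [measurable]: "(\<lambda>\<omega>. X \<omega> ** cadjoint (X \<omega>)) \<in> borel_measurable M"
      "(\<lambda>\<omega>. cadjoint (X \<omega>) ** X \<omega>) \<in> borel_measurable M"
    using measurable_compose[OF \<open>X \<in> borel_measurable M\<close> borel_measurable_mult_cadjoint(1)]
      measurable_compose[OF \<open>X \<in> borel_measurable M\<close> borel_measurable_mult_cadjoint(2)] by simp_all
  have VG [measurable]: "V \<in> borel_measurable G" "V' \<in> borel_measurable G"
    unfolding V_def V'_def by (rule borel_measurable_matrix_cond_exp)+
  have nX: "AE \<omega> in M. norm (X \<omega>) \<le> real (CARD('r) * CARD('c)) * R"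
    using X(1) by eventually_elim (intro order_trans[OF norm_matrix_le_spectral_norm] mult_left_mono, auto)
  have nXX: "AE \<omega> in M. norm (X \<omega> ** cadjoint (X \<omega>)) \<le> real (CARD('r) * CARD('r)) * (R * R)"
    using X(1) by eventually_elim (rule norm_mult_cadjoint_le)
  have nXX': "AE \<omega> in M. norm (cadjoint (X \<omega>) ** X \<omega>) \<le> real (CARD('c) * CARD('c)) * (R * R)"
    using X(1) by eventually_elim (rule norm_mult_cadjoint_le)
  note nV = AE_norm_matrix_cond_exp_le[OF prob sub XX(1) nXX, folded V_def]
  note nV' = AE_norm_matrix_cond_exp_le[OF prob sub XX(2) nXX', folded V'_def]
  have V_herm: "AE \<omega> in M. cadjoint (V \<omega>) = V \<omega>"
    unfolding V_def by (rule AE_cadjoint_matrix_cond_exp[OF prob sub XX(1) nXX]) (simp add: cadjoint_matrix_mult)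
  have V'_herm: "AE \<omega> in M. cadjoint (V' \<omega>) = V' \<omega>"
    unfolding V'_def by (rule AE_cadjoint_matrix_cond_exp[OF prob sub XX(2) nXX']) (simp add: cadjoint_matrix_mult)
  have bound_add: "\<exists>K. AE \<omega> in M. norm (f \<omega> + h \<omega>) \<le> K"
    if "AE \<omega> in M. norm (f \<omega>) \<le> k" "AE \<omega> in M. norm (h \<omega>) \<le> l" for f h :: "'a \<Rightarrow> 'e::real_normed_vector" and k l :: real
    using that by (intro exI[of _ "k + l"], eventually_elim) (rule norm_triangle_mono)
  obtain b' where b': "AE \<omega> in M. norm (P \<omega> + V \<omega>) \<le> b'"
    using bound_add[OF P(1) nV] by blast
  obtain c' where c': "AE \<omega> in M. norm (Q \<omega> + V' \<omega>) \<le> c'"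
    using bound_add[OF Q(1) nV'] by blast
  obtain a' where a': "AE \<omega> in M. norm (Y \<omega> + X \<omega>) \<le> a'"
    using bound_add[OF Y nX] by blast

  \<comment> \<open>The compensators are already advanced while the martingale is not. As
    \<open>V\<close> and \<open>V'\<close> are \<open>G\<close>-measurable, so is
    \<open>H\<close>.\<close>
  define H where "H \<omega> = compensated \<theta> g (Y \<omega>, P \<omega> + V \<omega>, Q \<omega> + V' \<omega>)" for \<omega>
  have HG [measurable]: "H \<in> borel_measurable G"
    unfolding H_def by measurable
  obtain K where K: "AE \<omega> in M. norm (H \<omega>) \<le> K"
    unfolding H_def using AE_norm_compensated_le[OF Y b' c'] by blast
  have H_sym: "AE \<omega> in M. adj (H \<omega>) = H \<omega>"
    using P(2) Q(2) V_herm V'_herm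
    by eventually_elim (simp add: H_def compensated_def adj_dilation adj_block_diag cadjoint_add)

  \<comment> \<open>The remainder is quadratic in \<open>X\<close>, but it is a sum of linear images
    of \<open>X\<close> and of its two products with the adjoint. Take-out applies to each of the
    three.\<close>
  define L1 where "L1 = (\<lambda>Z :: complex ^ 'c ^ 'r. \<theta> *\<^sub>R dilation Z)"
  define L2 where "L2 = (\<lambda>Z :: complex ^ 'r ^ 'r. g *\<^sub>R block_diag Z (0 :: complex ^ 'c ^ 'c))"
  define L3 where "L3 = (\<lambda>Z :: complex ^ 'c ^ 'c. g *\<^sub>R block_diag (0 :: complex ^ 'r ^ 'r) Z)"
  have "linear L1"
    unfolding L1_def by (intro linear_compose_scale_right linear_dilation)
  have "linear L2"
    by (rule linearI)
      (simp_all add: L2_def linear_add[OF linear_block_diag, of "(_, 0)" "(_, 0)", simplified]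
        linear_scale[OF linear_block_diag, of _ "(_, 0)", simplified] scaleR_add_right)
  have "linear L3"
    by (rule linearI)
      (simp_all add: L3_def linear_add[OF linear_block_diag, of "(0, _)" "(0, _)", simplified]
        linear_scale[OF linear_block_diag, of _ "(0, _)", simplified] scaleR_add_right)
  note int1 = integrable_tr_exp_mult[OF prob sub \<open>X \<in> borel_measurable M\<close> nX HG K \<open>linear L1\<close> \<open>A \<in> sets G\<close>]
    and eq1 = integral_tr_exp_mult_cond_exp[OF prob sub \<open>X \<in> borel_measurable M\<close> nX HG K \<open>linear L1\<close> \<open>A \<in> sets G\<close>]
  note int2 = integrable_tr_exp_mult[OF prob sub XX(1) nXX HG K \<open>linear L2\<close> \<open>A \<in> sets G\<close>]
    and int2' = integrable_tr_exp_mult_cond_exp[OF prob sub XX(1) nXX HG K \<open>linear L2\<close> \<open>A \<in> sets G\<close>, folded V_def]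
    and eq2 = integral_tr_exp_mult_cond_exp[OF prob sub XX(1) nXX HG K \<open>linear L2\<close> \<open>A \<in> sets G\<close>, folded V_def]
  note int3 = integrable_tr_exp_mult[OF prob sub XX(2) nXX' HG K \<open>linear L3\<close> \<open>A \<in> sets G\<close>]
    and int3' = integrable_tr_exp_mult_cond_exp[OF prob sub XX(2) nXX' HG K \<open>linear L3\<close> \<open>A \<in> sets G\<close>, folded V'_def]
    and eq3 = integral_tr_exp_mult_cond_exp[OF prob sub XX(2) nXX' HG K \<open>linear L3\<close> \<open>A \<in> sets G\<close>, folded V'_def]
  have intA: "integrable M (\<lambda>\<omega>. indicator A \<omega> * tr (exp (f \<omega>)))"
    if "f \<in> borel_measurable M" "AE \<omega> in M. norm (f \<omega>) \<le> k" for f :: "'a \<Rightarrow> ((complex ^ 'r) \<times> (complex ^ 'c)) endo" and k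
    using integrable_mult_indicator[OF AM integrable_tr_exp[OF that]] by simp
  have int0: "integrable M (\<lambda>\<omega>. indicator A \<omega> * tr (exp (H \<omega>)))"
    by (rule intA[OF _ K]) measurable
  have int_new: "integrable M (\<lambda>\<omega>. indicator A \<omega> * tr (exp (compensated \<theta> g (Y \<omega> + X \<omega>, P \<omega> + V \<omega>, Q \<omega> + V' \<omega>))))"
  proof -
    obtain k where "AE \<omega> in M. norm (compensated \<theta> g (Y \<omega> + X \<omega>, P \<omega> + V \<omega>, Q \<omega> + V' \<omega>)) \<le> k"
      using AE_norm_compensated_le[OF a' b' c'] by blast
    then show ?thesis
      by (intro intA) measurable
  qed
  have int_old: "integrable M (\<lambda>\<omega>. indicator A \<omega> * tr (exp (compensated \<theta> g (Y \<omega>, P \<omega>, Q \<omega>))))"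
  proof -
    obtain k where "AE \<omega> in M. norm (compensated \<theta> g (Y \<omega>, P \<omega>, Q \<omega>)) \<le> k"
      using AE_norm_compensated_le[OF Y P(1) Q(1)] by blast
    then show ?thesis
      by (intro intA) measurable
  qed
  let ?J = "\<lambda>U. \<integral>\<omega>. indicator A \<omega> * tr (exp (H \<omega>) * U \<omega>) \<partial>M"
  let ?I = "\<integral>\<omega>. indicator A \<omega> * tr (exp (H \<omega>)) \<partial>M"

  have "(\<integral>\<omega>. indicator A \<omega> * tr (exp (compensated \<theta> g (Y \<omega> + X \<omega>, P \<omega> + V \<omega>, Q \<omega> + V' \<omega>))) \<partial>M)
      \<le> (\<integral>\<omega>. indicator A \<omega> * tr (exp (H \<omega>)) + (indicator A \<omega> * tr (exp (H \<omega>) * L1 (X \<omega>))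
        + (indicator A \<omega> * tr (exp (H \<omega>) * L2 (X \<omega> ** cadjoint (X \<omega>)))
        + indicator A \<omega> * tr (exp (H \<omega>) * L3 (cadjoint (X \<omega>) ** X \<omega>)))) \<partial>M)"
  proof (rule integral_mono_AE[OF int_new])
    show "AE \<omega> in M. indicator A \<omega> * tr (exp (compensated \<theta> g (Y \<omega> + X \<omega>, P \<omega> + V \<omega>, Q \<omega> + V' \<omega>)))
      \<le> indicator A \<omega> * tr (exp (H \<omega>)) + (indicator A \<omega> * tr (exp (H \<omega>) * L1 (X \<omega>))
        + (indicator A \<omega> * tr (exp (H \<omega>) * L2 (X \<omega> ** cadjoint (X \<omega>)))
        + indicator A \<omega> * tr (exp (H \<omega>) * L3 (cadjoint (X \<omega>) ** X \<omega>))))"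
      using X(1) H_sym
    proof eventually_elim
      case (elim \<omega>)
      let ?X = "\<theta> *\<^sub>R dilation (X \<omega>)"
      have sym: "adj ?X = ?X"
        by (simp add: adj_dilation)
      have "norm ?X \<le> \<theta> * R"
        using \<theta>(1) elim(1) order_trans[OF norm_dilation_le elim(1)] by (simp add: mult_left_mono)
      have "compensated \<theta> g (Y \<omega> + X \<omega>, P \<omega> + V \<omega>, Q \<omega> + V' \<omega>) = H \<omega> + ?X"
        by (simp add: H_def compensated_def linear_add[OF linear_dilation] scaleR_add_right)
      then have "tr (exp (compensated \<theta> g (Y \<omega> + X \<omega>, P \<omega> + V \<omega>, Q \<omega> + V' \<omega>))) \<le> tr (exp (H \<omega>) * exp ?X)"
        using golden_thompson[OF elim(2) sym] by simp
      also have "\<dots> \<le> tr (exp (H \<omega>) * (1 + ?X + (1 / (2 * (1 - \<theta> * R / 3))) *\<^sub>R (?X * ?X)))"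
        using \<open>norm ?X \<le> \<theta> * R\<close> \<theta>(2) by (intro tr_exp_mult_exp_le elim(2) sym)
      also have "(1 / (2 * (1 - \<theta> * R / 3))) *\<^sub>R (?X * ?X) = g *\<^sub>R (dilation (X \<omega>) * dilation (X \<omega>))"
        by (simp add: g power2_eq_square)
      also have "\<dots> = L2 (X \<omega> ** cadjoint (X \<omega>)) + L3 (cadjoint (X \<omega>) ** X \<omega>)"
        by (simp add: L2_def L3_def dilation_square flip: block_diag_add scaleR_add_right)
      finally have "tr (exp (compensated \<theta> g (Y \<omega> + X \<omega>, P \<omega> + V \<omega>, Q \<omega> + V' \<omega>)))
          \<le> tr (exp (H \<omega>)) + (tr (exp (H \<omega>) * L1 (X \<omega>))
            + (tr (exp (H \<omega>) * L2 (X \<omega> ** cadjoint (X \<omega>))) + tr (exp (H \<omega>) * L3 (cadjoint (X \<omega>) ** X \<omega>))))"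
        by (simp add: L1_def distrib_left tr_simps add.assoc)
      then show ?case
        by (simp add: indicator_def)
    qed
  qed (intro Bochner_Integration.integrable_add int0 int1 int2 int3)
  also have "\<dots> = ?I + (?J (\<lambda>\<omega>. L1 (X \<omega>)) + (?J (\<lambda>\<omega>. L2 (X \<omega> ** cadjoint (X \<omega>))) + ?J (\<lambda>\<omega>. L3 (cadjoint (X \<omega>) ** X \<omega>))))"
    by (simp only: Bochner_Integration.integral_add Bochner_Integration.integrable_add int0 int1 int2 int3)
  \<comment> \<open>The first-order term vanishes because the increment has conditional mean
    zero.\<close>
  also have "?J (\<lambda>\<omega>. L1 (X \<omega>)) = 0"
  proof -
    have "AE \<omega> in M. indicator A \<omega> * tr (exp (H \<omega>) * L1 (matrix_cond_exp M G X \<omega>)) = 0"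
      using X(2) by eventually_elim (simp add: linear_0[OF \<open>linear L1\<close>] tr_simps)
    then have "?J (\<lambda>\<omega>. L1 (matrix_cond_exp M G X \<omega>)) = 0"
      by (rule integral_eq_zero_AE)
    then show ?thesis
      by (simp only: eq1)
  qed
  also have "?I + (0 + (?J (\<lambda>\<omega>. L2 (X \<omega> ** cadjoint (X \<omega>))) + ?J (\<lambda>\<omega>. L3 (cadjoint (X \<omega>) ** X \<omega>))))
      = (\<integral>\<omega>. indicator A \<omega> * tr (exp (H \<omega>)) + (indicator A \<omega> * tr (exp (H \<omega>) * L2 (V \<omega>))
        + indicator A \<omega> * tr (exp (H \<omega>) * L3 (V' \<omega>))) \<partial>M)"
    by (simp only: Bochner_Integration.integral_add Bochner_Integration.integrable_add int0 int2' int3' eq2 eq3 add_0)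
  \<comment> \<open>The tangent bound \<open>tr_exp_mult_le\<close> replaces \<open>1 + ?C\<close>
    by adding \<open>?C\<close> inside the exponential, where it cancels the advance of the
    compensators.\<close>
  also have "\<dots> \<le> (\<integral>\<omega>. indicator A \<omega> * tr (exp (compensated \<theta> g (Y \<omega>, P \<omega>, Q \<omega>))) \<partial>M)"
  proof (rule integral_mono_AE[OF _ int_old])
    show "AE \<omega> in M. indicator A \<omega> * tr (exp (H \<omega>)) + (indicator A \<omega> * tr (exp (H \<omega>) * L2 (V \<omega>))
        + indicator A \<omega> * tr (exp (H \<omega>) * L3 (V' \<omega>)))
      \<le> indicator A \<omega> * tr (exp (compensated \<theta> g (Y \<omega>, P \<omega>, Q \<omega>)))"
      using H_sym V_herm V'_herm
    proof eventually_elim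
      case (elim \<omega>)
      let ?C = "g *\<^sub>R block_diag (V \<omega>) (V' \<omega>)"
      have sym: "adj ?C = ?C"
        by (simp add: adj_block_diag elim)
      have C: "?C = L2 (V \<omega>) + L3 (V' \<omega>)"
        by (simp add: L2_def L3_def flip: block_diag_add scaleR_add_right)
      have "H \<omega> + ?C = compensated \<theta> g (Y \<omega>, P \<omega>, Q \<omega>)"
        by (simp add: H_def compensated_def block_diag_add scaleR_add_right)
      then have "tr (exp (H \<omega>) * (1 + ?C)) \<le> tr (exp (compensated \<theta> g (Y \<omega>, P \<omega>, Q \<omega>)))"
        using tr_exp_mult_le[OF elim(1) sym] by simp
      then show ?case
        by (simp add: C distrib_left tr_simps indicator_def)
    qed
  qed (intro Bochner_Integration.integrable_add int0 int2' int3')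
  finally show ?thesis .
qed

lemma (in prob_space) AE_matrix_cond_exp_diff:
  fixes Z Y :: "'a \<Rightarrow> complex ^ 'c ^ 'r" and C D :: real
  assumes sub: "subalgebra M G"
    and [measurable]: "Z \<in> borel_measurable M" "Y \<in> borel_measurable G"
    and Z: "AE \<omega> in M. norm (Z \<omega>) \<le> C" and Y: "AE \<omega> in M. norm (Y \<omega>) \<le> D"
  shows "AE \<omega> in M. matrix_cond_exp M G (\<lambda>\<omega>. Z \<omega> - Y \<omega>) \<omega> = matrix_cond_exp M G Z \<omega> - Y \<omega>"
proof -
  interpret finite_measure_subalgebra M G
    by unfold_locales (rule sub)
  have [measurable]: "Y \<in> borel_measurable M"
    using measurable_from_subalg[OF sub \<open>Y \<in> borel_measurable G\<close>] .
  have "AE \<omega> in M. matrix_cond_exp M G (\<lambda>\<omega>. Z \<omega> - Y \<omega>) \<omega> \<bullet> b = (matrix_cond_exp M G Z \<omega> - Y \<omega>) \<bullet> b"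
    if b: "b \<in> Basis" for b
  proof -
    have "AE \<omega> in M. norm (Z \<omega> \<bullet> b) \<le> C"
      unfolding real_norm_def using Z by eventually_elim (rule order_trans[OF Basis_le_norm[OF b]])
    then have Zb: "integrable M (\<lambda>\<omega>. Z \<omega> \<bullet> b)"
      by (rule integrable_const_bound) measurable
    have "AE \<omega> in M. norm (Y \<omega> \<bullet> b) \<le> D"
      unfolding real_norm_def using Y by eventually_elim (rule order_trans[OF Basis_le_norm[OF b]])
    then have Yb: "integrable M (\<lambda>\<omega>. Y \<omega> \<bullet> b)"
      by (rule integrable_const_bound) measurable
    have "(\<lambda>\<omega>. Y \<omega> \<bullet> b) \<in> borel_measurable G"
      by measurable
    from real_cond_exp_diff[OF Zb Yb] real_cond_exp_F_meas[OF Yb this] show ?thesis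
      unfolding inner_diff_left matrix_cond_exp_inner_Basis[OF b]
      by eventually_elim (auto simp: inner_diff_left)
  qed
  then have "AE \<omega> in M. \<forall>b\<in>Basis. matrix_cond_exp M G (\<lambda>\<omega>. Z \<omega> - Y \<omega>) \<omega> \<bullet> b = (matrix_cond_exp M G Z \<omega> - Y \<omega>) \<bullet> b"
    by (intro AE_finite_allI finite_Basis) auto
  then show ?thesis
    by eventually_elim (blast intro: euclidean_eqI)
qed

section \<open>The tail bound for rectangular matrix martingales\<close>

theorem corollary1p3:
  fixes M :: "'a measure"
    and F :: "nat \<Rightarrow> 'a measure"
    and Y :: "nat \<Rightarrow> 'a \<Rightarrow> complex ^ 'd2 ^ 'd1"
    and R t \<sigma> :: real
  assumes "prob_space M"
    and "filtration (space M) F"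
    and "\<And>k. subalgebra M (F k)"
    and "matrix_martingale M F Y"
    and "\<And>k. k \<ge> 1 \<Longrightarrow> AE \<omega> in M. spectral_norm (difference_sequence Y k \<omega>) \<le> R"
    and "t \<ge> 0"
    and "\<sigma>\<^sup>2 > 0"
  shows "measure M {\<omega> \<in> space M. \<exists>k. spectral_norm (Y k \<omega>) \<ge> t \<and>
             max (spectral_norm (W_col M F Y k \<omega>)) (spectral_norm (W_row M F Y k \<omega>)) \<le> \<sigma>\<^sup>2}
         \<le> (real CARD('d1) + real CARD('d2)) * exp ((- t\<^sup>2 / 2) / (\<sigma>\<^sup>2 + R * t / 3))"
proof -
  interpret prob_space M
    by fact
  note sub = assms(3)
  let ?X = "difference_sequence Y" and ?Wc = "W_col M F Y" and ?Wr = "W_row M F Y"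
  have YF: "Y k \<in> borel_measurable (F k)" for k
    using assms(4) by (simp add: matrix_martingale_def)
  have mono: "f \<in> borel_measurable (F k)" if "f \<in> borel_measurable (F j)" "j \<le> k"
    for f :: "'a \<Rightarrow> 'e::topological_space" and j k
    by (rule measurable_from_subalg[OF _ that(1)])
      (use filtration.space_F[OF assms(2)] filtration.sets_F_mono[OF assms(2) that(2)] in \<open>simp add: subalgebra_def\<close>)
  have from_F: "f \<in> borel_measurable M" if "f \<in> borel_measurable (F k)"
    for f :: "'a \<Rightarrow> 'e::topological_space" and k
    using measurable_from_subalg[OF sub that] .
  have XS: "?X (Suc k) = (\<lambda>\<omega>. Y (Suc k) \<omega> - Y k \<omega>)" for k
    by (simp add: fun_eq_iff difference_sequence_def)
  have XM [measurable]: "?X (Suc k) \<in> borel_measurable M" for k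
    unfolding XS using from_F[OF YF] by measurable
  have X_le: "AE \<omega> in M. spectral_norm (?X (Suc k) \<omega>) \<le> R" for k
    using assms(5)[of "Suc k"] by simp
  \<comment> \<open>The sign of \<open>R\<close> comes from the bound on the first increment: a
    constant inequality that holds almost surely in a probability space holds outright.\<close>
  have "AE \<omega> in M. 0 \<le> R"
    using X_le[of 0] by eventually_elim (rule order_trans[OF spectral_norm_nonneg])
  then have R: "0 \<le> R"
    by simp

  \<comment> \<open>Predictability: up to time \<open>Suc k\<close> only conditional expectations
    given \<open>F 0\<close> to \<open>F k\<close> enter, hence the range
    \<open>j \<le> Suc k\<close>.\<close>
  have WcF: "?Wc j \<in> borel_measurable (F k)" if "j \<le> Suc k" for j k
  proof -
    have "(\<lambda>\<omega>. matrix_cond_exp M (F (i - 1)) (\<lambda>\<omega>. ?X i \<omega> ** cadjoint (?X i \<omega>)) \<omega>) \<in> borel_measurable (F k)"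
      if "i \<in> {1..j}" for i
      using that \<open>j \<le> Suc k\<close> by (intro mono[OF borel_measurable_matrix_cond_exp]) auto
    then show ?thesis
      unfolding W_col_def by (rule borel_measurable_sum)
  qed
  have WrF: "?Wr j \<in> borel_measurable (F k)" if "j \<le> Suc k" for j k
  proof -
    have "(\<lambda>\<omega>. matrix_cond_exp M (F (i - 1)) (\<lambda>\<omega>. cadjoint (?X i \<omega>) ** ?X i \<omega>) \<omega>) \<in> borel_measurable (F k)"
      if "i \<in> {1..j}" for i
      using that \<open>j \<le> Suc k\<close> by (intro mono[OF borel_measurable_matrix_cond_exp]) auto
    then show ?thesis
      unfolding W_row_def by (rule borel_measurable_sum)
  qed
  have WcS: "?Wc (Suc k) \<omega> = ?Wc k \<omega> + matrix_cond_exp M (F k) (\<lambda>\<omega>. ?X (Suc k) \<omega> ** cadjoint (?X (Suc k) \<omega>)) \<omega>" for k \<omega>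
    by (simp add: W_col_def)
  have WrS: "?Wr (Suc k) \<omega> = ?Wr k \<omega> + matrix_cond_exp M (F k) (\<lambda>\<omega>. cadjoint (?X (Suc k) \<omega>) ** ?X (Suc k) \<omega>) \<omega>" for k \<omega>
    by (simp add: W_row_def)

  \<comment> \<open>The null start and bounded increments make each \<open>Y k\<close> bounded, with
    a bound depending on \<open>k\<close>; this gives integrability of the trace
    exponentials.\<close>
  have Y_bound: "\<exists>a. AE \<omega> in M. norm (Y k \<omega>) \<le> a" for k
  proof (induction k)
    case 0
    have "AE \<omega> in M. Y 0 \<omega> = 0"
      using assms(4) by (simp add: matrix_martingale_def)
    then show ?case
      by (intro exI[of _ 0]) (auto elim: eventually_mono)
  next
    case (Suc k)
    then obtain a where "AE \<omega> in M. norm (Y k \<omega>) \<le> a" ..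
    with X_le[of k] have "AE \<omega> in M. norm (Y (Suc k) \<omega>) \<le> a + real (CARD('d1) * CARD('d2)) * R"
    proof eventually_elim
      case (elim \<omega>)
      have "norm (?X (Suc k) \<omega>) \<le> real (CARD('d1) * CARD('d2)) * R"
        using elim(1) by (intro order_trans[OF norm_matrix_le_spectral_norm] mult_left_mono) auto
      then have "norm (Y k \<omega> + ?X (Suc k) \<omega>) \<le> a + real (CARD('d1) * CARD('d2)) * R"
        by (intro norm_triangle_mono elim(2))
      then show ?case
        by (simp add: XS)
    qed
    then show ?case ..
  qed
  have X_mean: "AE \<omega> in M. matrix_cond_exp M (F k) (?X (Suc k)) \<omega> = 0" for k
  proof -
    obtain a b where "AE \<omega> in M. norm (Y (Suc k) \<omega>) \<le> a" "AE \<omega> in M. norm (Y k \<omega>) \<le> b"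
      using Y_bound by metis
    note AE_matrix_cond_exp_diff[OF sub from_F[OF YF] YF this]
    moreover have "AE \<omega> in M. matrix_cond_exp M (F k) (Y (Suc k)) \<omega> = Y k \<omega>"
      using assms(4) unfolding matrix_martingale_def by (metis diff_Suc_1 le_add1 plus_1_eq_Suc)
    ultimately show ?thesis
      unfolding XS by eventually_elim simp
  qed
  have XX: "(\<lambda>\<omega>. ?X (Suc k) \<omega> ** cadjoint (?X (Suc k) \<omega>)) \<in> borel_measurable M"
      "(\<lambda>\<omega>. cadjoint (?X (Suc k) \<omega>) ** ?X (Suc k) \<omega>) \<in> borel_measurable M" for k
    using measurable_compose[OF XM borel_measurable_mult_cadjoint(1)]
      measurable_compose[OF XM borel_measurable_mult_cadjoint(2)] by simp_all
  have nXX: "AE \<omega> in M. norm (?X (Suc k) \<omega> ** cadjoint (?X (Suc k) \<omega>)) \<le> real (CARD('d1) * CARD('d1)) * (R * R)" for k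
    using X_le[of k] by eventually_elim (rule norm_mult_cadjoint_le)
  have nXX': "AE \<omega> in M. norm (cadjoint (?X (Suc k) \<omega>) ** ?X (Suc k) \<omega>) \<le> real (CARD('d2) * CARD('d2)) * (R * R)" for k
    using X_le[of k] by eventually_elim (rule norm_mult_cadjoint_le)
  have Wc: "\<exists>b. AE \<omega> in M. norm (?Wc k \<omega>) \<le> b \<and> cadjoint (?Wc k \<omega>) = ?Wc k \<omega>" for k
  proof (induction k)
    case 0
    show ?case
      by (intro exI[of _ 0]) (simp add: W_col_def cadjoint_def vec_eq_iff)
  next
    case (Suc k)
    then obtain b where "AE \<omega> in M. norm (?Wc k \<omega>) \<le> b \<and> cadjoint (?Wc k \<omega>) = ?Wc k \<omega>" ..
    moreover have "AE \<omega> in M. cadjoint (matrix_cond_exp M (F k) (\<lambda>\<omega>. ?X (Suc k) \<omega> ** cadjoint (?X (Suc k) \<omega>)) \<omega>)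
        = matrix_cond_exp M (F k) (\<lambda>\<omega>. ?X (Suc k) \<omega> ** cadjoint (?X (Suc k) \<omega>)) \<omega>"
      by (rule AE_cadjoint_matrix_cond_exp[OF assms(1) sub XX(1) nXX]) (simp add: cadjoint_matrix_mult)
    ultimately show ?case
      using AE_norm_matrix_cond_exp_le[OF assms(1) sub XX(1) nXX, of k]
      by (intro exI[of _ "b + _"], eventually_elim) (simp only: WcS cadjoint_add, blast intro: norm_triangle_mono)
  qed
  have Wr: "\<exists>b. AE \<omega> in M. norm (?Wr k \<omega>) \<le> b \<and> cadjoint (?Wr k \<omega>) = ?Wr k \<omega>" for k
  proof (induction k)
    case 0
    show ?case
      by (intro exI[of _ 0]) (simp add: W_row_def cadjoint_def vec_eq_iff)
  next
    case (Suc k)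
    then obtain b where "AE \<omega> in M. norm (?Wr k \<omega>) \<le> b \<and> cadjoint (?Wr k \<omega>) = ?Wr k \<omega>" ..
    moreover have "AE \<omega> in M. cadjoint (matrix_cond_exp M (F k) (\<lambda>\<omega>. cadjoint (?X (Suc k) \<omega>) ** ?X (Suc k) \<omega>) \<omega>)
        = matrix_cond_exp M (F k) (\<lambda>\<omega>. cadjoint (?X (Suc k) \<omega>) ** ?X (Suc k) \<omega>) \<omega>"
      by (rule AE_cadjoint_matrix_cond_exp[OF assms(1) sub XX(2) nXX']) (simp add: cadjoint_matrix_mult)
    ultimately show ?case
      using AE_norm_matrix_cond_exp_le[OF assms(1) sub XX(2) nXX', of k]
      by (intro exI[of _ "b + _"], eventually_elim) (simp only: WrS cadjoint_add, blast intro: norm_triangle_mono)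
  qed

  \<comment> \<open>With \<open>\<theta> = t / D\<close> one gets
    \<open>1 - \<theta> * R / 3 = \<sigma>\<^sup>2 / D\<close>. This gives
    \<open>\<theta> * R < 3\<close> and makes the exponent
    \<open>\<theta> * t - g * \<sigma>\<^sup>2\<close> equal to
    \<open>t\<^sup>2 / (2 * D)\<close>.\<close>
  define D where "D = \<sigma>\<^sup>2 + R * t / 3"
  define \<theta> where "\<theta> = t / D"
  define g where "g = \<theta>\<^sup>2 / (2 * (1 - \<theta> * R / 3))"
  define S where "S k \<omega> = tr (exp (compensated \<theta> g (Y k \<omega>, ?Wc k \<omega>, ?Wr k \<omega>)))" for k \<omega>
  have D: "0 < D"
    using assms(6,7) R by (simp add: D_def add_pos_nonneg)
  have \<theta>: "0 \<le> \<theta>"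
    using D assms(6) by (simp add: \<theta>_def)
  have frac: "1 - \<theta> * R / 3 = \<sigma>\<^sup>2 / D"
  proof -
    have "1 - \<theta> * R / 3 = (D - R * t / 3) / D"
      using D by (simp add: \<theta>_def diff_divide_distrib mult.commute)
    then show ?thesis
      by (simp add: D_def)
  qed
  moreover have "0 < \<sigma>\<^sup>2 / D"
    using D assms(7) by simp
  ultimately have \<theta>R: "\<theta> * R < 3"
    by linarith
  have g: "g = t\<^sup>2 / (2 * D * \<sigma>\<^sup>2)"
    unfolding g_def frac using D by (simp add: \<theta>_def power_divide) (simp add: power2_eq_square)
  have g_nonneg: "0 \<le> g"
    using D by (simp add: g)
  have exponent: "\<theta> * t - g * \<sigma>\<^sup>2 = t\<^sup>2 / 2 / D"
  proof -
    have "g * \<sigma>\<^sup>2 = t\<^sup>2 / (2 * D)"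
      using assms(7) by (simp add: g)
    moreover have "\<theta> * t = t\<^sup>2 / D"
      by (simp add: \<theta>_def power2_eq_square)
    ultimately show ?thesis
      by simp
  qed

  define E where "E k = {\<omega> \<in> space M. t \<le> spectral_norm (Y k \<omega>) \<and>
      max (spectral_norm (?Wc k \<omega>)) (spectral_norm (?Wr k \<omega>)) \<le> \<sigma>\<^sup>2}" for k
  have S_ge: "AE \<omega> in M. \<omega> \<in> E k \<longrightarrow> 2 * exp (t\<^sup>2 / 2 / D) \<le> S k \<omega>" for k
  proof -
    obtain b c where "AE \<omega> in M. norm (?Wc k \<omega>) \<le> b \<and> cadjoint (?Wc k \<omega>) = ?Wc k \<omega>"
      and "AE \<omega> in M. norm (?Wr k \<omega>) \<le> c \<and> cadjoint (?Wr k \<omega>) = ?Wr k \<omega>"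
      using Wc[of k] Wr[of k] by blast
    then show ?thesis
    proof eventually_elim
      case (elim \<omega>)
      then show ?case
        using tr_exp_dilation_ge[of "?Wc k \<omega>" "?Wr k \<omega>" "\<sigma>\<^sup>2" g \<theta> t "Y k \<omega>"] g_nonneg \<theta>
        by (auto simp: E_def S_def compensated_def exponent)
    qed
  qed
  have S_nonneg: "AE \<omega> in M. 0 \<le> S k \<omega>" for k
  proof -
    obtain b c where "AE \<omega> in M. norm (?Wc k \<omega>) \<le> b \<and> cadjoint (?Wc k \<omega>) = ?Wc k \<omega>"
      and "AE \<omega> in M. norm (?Wr k \<omega>) \<le> c \<and> cadjoint (?Wr k \<omega>) = ?Wr k \<omega>"
      using Wc[of k] Wr[of k] by blast
    then show ?thesis
      by eventually_elim (simp add: S_def compensated_def tr_exp_nonneg adj_dilation adj_block_diag)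
  qed
  have "2 * exp (t\<^sup>2 / 2 / D) * measure M (\<Union>k. E k) \<le> (\<integral>\<omega>. S 0 \<omega> \<partial>M)"
  proof (rule stopped_maximal_inequality[OF assms(1-3) _ S_nonneg _ _ S_ge])
    show "integrable M (S k)" for k
    proof -
      obtain a b c where "AE \<omega> in M. norm (Y k \<omega>) \<le> a" "AE \<omega> in M. norm (?Wc k \<omega>) \<le> b" "AE \<omega> in M. norm (?Wr k \<omega>) \<le> c"
        using Y_bound[of k] Wc[of k] Wr[of k] by auto
      then obtain K where K: "AE \<omega> in M. norm (compensated \<theta> g (Y k \<omega>, ?Wc k \<omega>, ?Wr k \<omega>)) \<le> K"
        using AE_norm_compensated_le by blast
      have [measurable]: "Y k \<in> borel_measurable M" "?Wc k \<in> borel_measurable M" "?Wr k \<in> borel_measurable M"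
        using from_F[OF YF] from_F[OF WcF[of k k]] from_F[OF WrF[of k k]] by auto
      show ?thesis
        unfolding S_def by (rule integrable_tr_exp[OF _ K]) measurable
    qed
    show "E k \<in> sets (F k)" for k
    proof -
      have [measurable]: "Y k \<in> borel_measurable (F k)" "?Wc k \<in> borel_measurable (F k)" "?Wr k \<in> borel_measurable (F k)"
        using YF WcF WrF by auto
      have "E k = {\<omega> \<in> space (F k). t \<le> spectral_norm (Y k \<omega>) \<and>
          max (spectral_norm (?Wc k \<omega>)) (spectral_norm (?Wr k \<omega>)) \<le> \<sigma>\<^sup>2}"
        by (simp add: E_def filtration.space_F[OF assms(2)])
      also have "\<dots> \<in> sets (F k)"
        by measurable
      finally show ?thesis .
    qed
    fix k A
    assume A: "A \<in> sets (F k)"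
    obtain a b c where "AE \<omega> in M. norm (Y k \<omega>) \<le> a"
      "AE \<omega> in M. norm (?Wc k \<omega>) \<le> b" "AE \<omega> in M. cadjoint (?Wc k \<omega>) = ?Wc k \<omega>"
      "AE \<omega> in M. norm (?Wr k \<omega>) \<le> c" "AE \<omega> in M. cadjoint (?Wr k \<omega>) = ?Wr k \<omega>"
      using Y_bound[of k] Wc[of k] Wr[of k] by auto
    from integral_tr_exp_compensated_le[OF assms(1) sub XM YF WcF WrF A X_le X_mean this \<theta> \<theta>R g_def]
    show "(\<integral>\<omega>. indicator A \<omega> * S (Suc k) \<omega> \<partial>M) \<le> (\<integral>\<omega>. indicator A \<omega> * S k \<omega> \<partial>M)"
      by (simp add: S_def WcS WrS XS)
  qed
  \<comment> \<open>At time 0 the exponent vanishes almost surely, so \<open>S 0\<close> is the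
    trace of the identity, the real dimension of the product space. Its factor 2 cancels the one on
    the left.\<close>
  also have "(\<integral>\<omega>. S 0 \<omega> \<partial>M) = (\<integral>\<omega>. 2 * (real CARD('d1) + real CARD('d2)) \<partial>M)"
  proof (rule integral_cong_AE)
    have "AE \<omega> in M. Y 0 \<omega> = 0"
      using assms(4) by (simp add: matrix_martingale_def)
    then show "AE \<omega> in M. S 0 \<omega> = 2 * (real CARD('d1) + real CARD('d2))"
    proof eventually_elim
      case (elim \<omega>)
      have "compensated \<theta> g (Y 0 \<omega>, ?Wc 0 \<omega>, ?Wr 0 \<omega>) = 0"
        using elim linear_0[OF bounded_linear.linear[OF bounded_linear_compensated], of \<theta> g]
        by (simp add: W_col_def W_row_def zero_prod_def)
      then show ?case
        by (simp add: S_def tr_one)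
    qed
    have [measurable]: "Y 0 \<in> borel_measurable M" "?Wc 0 \<in> borel_measurable M" "?Wr 0 \<in> borel_measurable M"
      using from_F[OF YF] from_F[OF WcF[of 0 0]] from_F[OF WrF[of 0 0]] by auto
    show "S 0 \<in> borel_measurable M"
      unfolding S_def by measurable
  qed simp
  finally have "exp (t\<^sup>2 / 2 / D) * measure M (\<Union>k. E k) \<le> real CARD('d1) + real CARD('d2)"
    by (simp add: prob_space)
  then have "measure M (\<Union>k. E k) \<le> (real CARD('d1) + real CARD('d2)) * exp ((- t\<^sup>2 / 2) / D)"
    by (simp add: exp_minus field_simps)
  moreover have "(\<Union>k. E k) = {\<omega> \<in> space M. \<exists>k. spectral_norm (Y k \<omega>) \<ge> t \<and>
      max (spectral_norm (?Wc k \<omega>)) (spectral_norm (?Wr k \<omega>)) \<le> \<sigma>\<^sup>2}"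
    by (auto simp: E_def)
  ultimately show ?thesis
    by (simp add: D_def)
qed

end
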